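(* Let $\lambda=(p,q,r;a,b;x)$ satisfy $p,q,r,a,b\in\mathbb{R}$, ($0<p<r$ or $0<q<r$), $-1<x<1$, $x\neq 0$. Then $\lambda$ is an elementary solution to the closed-form problem if and only if a finite composition of the symmetries (S0)–(S3) (see context) carries $\lambda$ to a parameter of the same region, again denoted $\lambda=(p,q,r;a,b;x)$, which satisfies one of the following two conditions. (E1) $q=0$ and $b\in\mathbb{Z}_{\le 0}$; in this case $f(w)$ itself is a rational function of $w$, the hypergeometric series defining it being terminating. (E2) $p=q=\frac r2>0$, $a=i$, $b=j-\frac12$ for some $i,j\in\mathbb{Z}$ (here the roles of $a$ and $b$ may be interchanged by symmetry (S0)). In this case, after the scaling $w\mapsto w/r$, $$f(w/r)={}_2F_1\Big(\frac w2+i,\ \frac{w-1}{2}+j;\ w;\ x\Big)=S_{ij}(w;x)\cdot\Big(\frac{1+\sqrt{1-x}}{2}\Big)^{1-w},$$ where $S_{00}(w;x)=1$ and $S_{ij}(w;x)$ is the rational function of $w$ given by $$S_{ij}(w;x)=(1-x)^{-\frac{i+j}{2}}\,F_3\Big(i+j,\,j-i;\ 1-i-j,\,1+i-j;\ w;\ -\frac{1-\sqrt{1-x}}{2\sqrt{1-x}},\ \frac{1-\sqrt{1-x}}{2}\Big).$$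
   Context: ${}_2F_1(\alpha,\beta;\gamma;z)=\sum_{k\ge0}\frac{(\alpha)_k(\beta)_k}{(\gamma)_k(1)_k}z^k$ with $(t)_k=t(t+1)\cdots(t+k-1)$. For a parameter $\lambda=(p,q,r;a,b;x)$ with $|x|<1$ put $f(w)=f(w;\lambda)={}_2F_1(pw+a,\,qw+b;\,rw;\,x)$, a meromorphic function of $w\in\mathbb{C}$. The parameter $\lambda$ is a solution to the closed-form problem if $f(w+1)/f(w)$ is a rational function of $w$. A solution is elementary if $f(w)$ has at most finitely many poles in $\mathbb{C}$. Symmetries: $\lambda=(p,q,r;a,b;x)$ is mapped to (S0) $(q,p,r;b,a;x)$; (S1) $(r-p,\,r-q,\,r;\,-a,\,-b;\,x)$; (S2) $(p,\,r-q,\,r;\,a,\,-b;\,x/(x-1))$; (S3) $(r-p,\,q,\,r;\,-a,\,b;\,x/(x-1))$. Appell's series: $F_3(\alpha_1,\alpha_2;\beta_1,\beta_2;\gamma;u,v)=\sum_{i,j\ge0}\frac{(\alpha_1)_i(\alpha_2)_j(\beta_1)_i(\beta_2)_j}{(\gamma)_{i+j}\,i!\,j!}u^iv^j$, which is terminating for the arguments used here. *)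

theory Defs
  imports "HOL-Complex_Analysis.Complex_Analysis"
begin

section \<open>Hypergeometric series\<close>

definition hyp2F1_term :: "complex \<Rightarrow> complex \<Rightarrow> complex \<Rightarrow> complex \<Rightarrow> nat \<Rightarrow> complex" where
  "hyp2F1_term \<alpha> \<beta> \<gamma> z k =
     pochhammer \<alpha> k * pochhammer \<beta> k / (pochhammer \<gamma> k * pochhammer 1 k) * z ^ k"

definition hyp2F1 :: "complex \<Rightarrow> complex \<Rightarrow> complex \<Rightarrow> complex \<Rightarrow> complex" where
  "hyp2F1 \<alpha> \<beta> \<gamma> z = (\<Sum>k. hyp2F1_term \<alpha> \<beta> \<gamma> z k)"

lemma hyp2F1_eq_eval_fps: "hyp2F1 \<alpha> \<beta> \<gamma> z = eval_fps (fps_hypergeo [\<alpha>, \<beta>] [\<gamma>] 1) z"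
  by (simp add: hyp2F1_def hyp2F1_term_def eval_fps_def pochhammer_fact [symmetric])

text \<open>Only used where all but finitely many terms of the double series vanish, so no
  condition of the form \<open>norm u < 1\<close>, \<open>norm v < 1\<close> is needed.\<close>

definition appell_F3 ::
  "complex \<Rightarrow> complex \<Rightarrow> complex \<Rightarrow> complex \<Rightarrow> complex \<Rightarrow> complex \<Rightarrow> complex \<Rightarrow> complex" where
  "appell_F3 \<alpha>\<^sub>1 \<alpha>\<^sub>2 \<beta>\<^sub>1 \<beta>\<^sub>2 \<gamma> u v =
     (\<Sum>\<^sub>\<infinity>(i, j)\<in>(UNIV :: (nat \<times> nat) set).
        pochhammer \<alpha>\<^sub>1 i * pochhammer \<alpha>\<^sub>2 j * pochhammer \<beta>\<^sub>1 i * pochhammer \<beta>\<^sub>2 j /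
        (pochhammer \<gamma> (i + j) * fact i * fact j) * u ^ i * v ^ j)"


section \<open>The closed-form problem\<close>

text \<open>Parameters \<open>(p, q, r, a, b, x)\<close>.\<close>

type_synonym param = "real \<times> real \<times> real \<times> real \<times> real \<times> real"

text \<open>The value of \<open>hyp_fun \<lambda> w\<close> is meaningful only where \<open>r * w\<close> is not a nonpositive
  integer (elsewhere the series contains divisions by \<open>0\<close>). The exceptional points are isolated
  when \<open>r \<noteq> 0\<close>, and all notions below are insensitive to the values there: identities of
  meromorphic functions are stated off a set without accumulation points, and \<open>is_pole\<close>
  depends on punctured neighbourhoods only.\<close>

fun hyp_fun :: "param \<Rightarrow> complex \<Rightarrow> complex" where
  "hyp_fun (p, q, r, a, b, x) w =
     hyp2F1 (of_real p * w + of_real a) (of_real q * w + of_real b) (of_real r * w) (of_real x)"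

definition is_rational_function :: "(complex \<Rightarrow> complex) \<Rightarrow> bool" where
  "is_rational_function g \<longleftrightarrow>
     (\<exists>P Q :: complex poly. Q \<noteq> 0 \<and> (\<forall>\<^sub>\<approx>w. g w = poly P w / poly Q w))"

definition closed_form_solution :: "param \<Rightarrow> bool" where
  "closed_form_solution lam \<longleftrightarrow>
     is_rational_function (\<lambda>w. hyp_fun lam (w + 1) / hyp_fun lam w)"

definition elementary_solution :: "param \<Rightarrow> bool" where
  "elementary_solution lam \<longleftrightarrow>
     closed_form_solution lam \<and> finite {w. is_pole (hyp_fun lam) w}"

fun in_region :: "param \<Rightarrow> bool" where
  "in_region (p, q, r, a, b, x) \<longleftrightarrow>
     (0 < p \<and> p < r \<or> 0 < q \<and> q < r) \<and> - 1 < x \<and> x < 1 \<and> x \<noteq> 0"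

text \<open>The symmetries act on arbitrary parameters; the reflexive-transitive closure of
  \<open>symmetry\<close> describes their finite compositions. Intermediate parameters need not
  satisfy \<open>\<bar>x\<bar> < 1\<close>.\<close>

inductive symmetry :: "param \<Rightarrow> param \<Rightarrow> bool" where
  S0: "symmetry (p, q, r, a, b, x) (q, p, r, b, a, x)"
| S1: "symmetry (p, q, r, a, b, x) (r - p, r - q, r, - a, - b, x)"
| S2: "symmetry (p, q, r, a, b, x) (p, r - q, r, a, - b, x / (x - 1))"
| S3: "symmetry (p, q, r, a, b, x) (r - p, q, r, - a, b, x / (x - 1))"

fun cond_E1 :: "param \<Rightarrow> bool" where
  "cond_E1 (p, q, r, a, b, x) \<longleftrightarrow> q = 0 \<and> b \<in> \<int>\<^sub>\<le>\<^sub>0"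

fun cond_E2 :: "int \<Rightarrow> int \<Rightarrow> param \<Rightarrow> bool" where
  "cond_E2 i j (p, q, r, a, b, x) \<longleftrightarrow>
     p = q \<and> q = r / 2 \<and> r / 2 > 0 \<and> a = of_int i \<and> b = of_int j - 1 / 2"

definition S_fun :: "int \<Rightarrow> int \<Rightarrow> real \<Rightarrow> complex \<Rightarrow> complex" where
  "S_fun i j x w =
     of_real ((1 - x) powr (- (of_int (i + j) / 2))) *
     appell_F3 (of_int (i + j)) (of_int (j - i)) (of_int (1 - i - j)) (of_int (1 + i - j)) w
       (of_real (- ((1 - sqrt (1 - x)) / (2 * sqrt (1 - x)))))
       (of_real ((1 - sqrt (1 - x)) / 2))"

end

theory Submission
  imports Defs "HOL-Real_Asymp.Real_Asymp"
begin

text \<open>Assume \<open>0 < p < r\<close> and put \<open>P = p / r\<close>, \<open>Q = q / r\<close>. The residue of the function at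
  \<open>w = -n / r\<close> is a nonzero multiple of the product of the Pochhammer symbols of order \<open>n + 1\<close> at
  \<open>a - P n\<close> and \<open>b - Q n\<close> with a hypergeometric value which, by Euler's integral, does not vanish for
  large \<open>n\<close>. So if there are only finitely many poles, then for every large \<open>n\<close> one of the numbers
  \<open>a - P n\<close>, \<open>b - Q n\<close> is an integer between \<open>-n\<close> and \<open>0\<close>. Since \<open>P\<close> lies strictly between \<open>0\<close>
  and \<open>1\<close>, this forces \<open>Q\<close> to be \<open>0\<close> or \<open>1\<close>, which is E1 up to symmetry, or \<open>P = Q = 1/2\<close>, which
  is E2.

  For the formula in E2, the numerator parameters of the terminating \<open>F\<^sub>3\<close> pair up as
  \<open>\<alpha>, 1 - \<alpha>\<close> and \<open>\<beta>, 1 - \<beta>\<close>, so that it arises from a product of two Bessel polynomials by the linear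
  map sending the monomial of degree \<open>m\<close> to \<open>1 / pochhammer w m\<close>. Because its arguments satisfy
  \<open>1 / u + 1 / v = 2\<close>, the differential relations of Bessel polynomials turn into the contiguous
  relations of the hypergeometric function, and only the case \<open>i = j = 0\<close> is left, a classical
  quadratic transformation.\<close>

subsection \<open>Rational functions\<close>

lemma eventually_cosparse_UNIV:
  "(\<forall>\<^sub>\<approx>w. P w) \<longleftrightarrow> (\<forall>w. eventually P (at w))"
  by (simp add: eventually_cosparse_open_eq)

lemma cosparse_poly_nonzero:
  fixes Q :: "complex poly"
  assumes "Q \<noteq> 0"
  shows "\<forall>\<^sub>\<approx>w. poly Q w \<noteq> 0"
proof -
  have "finite {w. poly Q w = 0}"
    using assms by (rule poly_roots_finite)
  then have "eventually (\<lambda>y. y \<notin> {w. poly Q w = 0}) (at w)" for w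
    using islimpt_finite islimpt_iff_eventually by blast
  then show ?thesis
    by (simp add: eventually_cosparse_UNIV)
qed

text \<open>An affine map with nonzero slope is injective and continuous, so it sends punctured
  neighbourhoods into punctured neighbourhoods. This serves both the shift by one and the scaling by
  \<open>r\<close>.\<close>

lemma eventually_cosparse_affine:
  assumes "\<forall>\<^sub>\<approx>w::complex. P w" "c \<noteq> 0"
  shows "\<forall>\<^sub>\<approx>w. P (c * w + d)"
  unfolding eventually_cosparse_UNIV
proof
  fix w
  have "filterlim (\<lambda>w. c * w + d) (at (c * w + d)) (at w)"
  proof (rule filterlim_atI)
    show "\<forall>\<^sub>F x in at w. c * x + d \<noteq> c * w + d"
      using assms(2) by (simp add: eventually_at_filter)
  qed (auto intro!: tendsto_eq_intros)
  then show "\<forall>\<^sub>F w in at w. P (c * w + d)"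
    using assms(1) unfolding eventually_cosparse_UNIV filterlim_iff by blast
qed

lemma is_rational_functionI:
  "Q \<noteq> 0 \<Longrightarrow> (\<And>w. poly Q w \<noteq> 0 \<Longrightarrow> g w = poly P w / poly Q w) \<Longrightarrow> is_rational_function g"
  unfolding is_rational_function_def
  using cosparse_poly_nonzero by (metis (mono_tags, lifting) eventually_mono)

lemma is_rational_function_cong:
  assumes "\<forall>\<^sub>\<approx>w. f w = g w"
  shows "is_rational_function f \<longleftrightarrow> is_rational_function g"
proof -
  have "(\<forall>\<^sub>\<approx>w. f w = h w) \<longleftrightarrow> (\<forall>\<^sub>\<approx>w. g w = h w)" for h
    using assms by (auto elim: eventually_elim2)
  then show ?thesis
    by (simp add: is_rational_function_def)
qed

lemma is_rational_function_const: "is_rational_function (\<lambda>_. c)"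
  by (rule is_rational_functionI[where Q = 1 and P = "[:c:]"]) auto

lemma is_rational_function_id: "is_rational_function (\<lambda>w. w)"
  by (rule is_rational_functionI[where Q = 1 and P = "[:0, 1:]"]) auto

lemma is_rational_function_add:
  assumes "is_rational_function f" "is_rational_function g"
  shows "is_rational_function (\<lambda>w. f w + g w)"
proof -
  obtain P Q where f: "Q \<noteq> 0" "\<forall>\<^sub>\<approx>w. f w = poly P w / poly Q w"
    using assms(1) by (auto simp: is_rational_function_def)
  obtain P' Q' where g: "Q' \<noteq> 0" "\<forall>\<^sub>\<approx>w. g w = poly P' w / poly Q' w"
    using assms(2) by (auto simp: is_rational_function_def)
  have "\<forall>\<^sub>\<approx>w. f w + g w = poly (P * Q' + P' * Q) w / poly (Q * Q') w"
    using f(2) g(2) cosparse_poly_nonzero[OF f(1)] cosparse_poly_nonzero[OF g(1)]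
    by eventually_elim (simp add: field_simps)
  then show ?thesis
    using f(1) g(1) unfolding is_rational_function_def by (meson mult_eq_0_iff)
qed

lemma is_rational_function_mult:
  assumes "is_rational_function f" "is_rational_function g"
  shows "is_rational_function (\<lambda>w. f w * g w)"
proof -
  obtain P Q where f: "Q \<noteq> 0" "\<forall>\<^sub>\<approx>w. f w = poly P w / poly Q w"
    using assms(1) by (auto simp: is_rational_function_def)
  obtain P' Q' where g: "Q' \<noteq> 0" "\<forall>\<^sub>\<approx>w. g w = poly P' w / poly Q' w"
    using assms(2) by (auto simp: is_rational_function_def)
  have "\<forall>\<^sub>\<approx>w. f w * g w = poly (P * P') w / poly (Q * Q') w"
    using f(2) g(2) by eventually_elim simp
  then show ?thesis
    using f(1) g(1) unfolding is_rational_function_def by (meson mult_eq_0_iff)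
qed

lemma is_rational_function_inverse:
  assumes "is_rational_function f"
  shows "is_rational_function (\<lambda>w. inverse (f w))"
proof -
  obtain P Q where f: "Q \<noteq> 0" "\<forall>\<^sub>\<approx>w. f w = poly P w / poly Q w"
    using assms by (auto simp: is_rational_function_def)
  show ?thesis
  proof (cases "P = 0")
    \<comment> \<open>As \<open>inverse 0 = 0\<close>, the inverse of the zero function is again the
      zero function.\<close>
    case True
    with f have "\<forall>\<^sub>\<approx>w. inverse (f w) = 0"
      by (auto elim: eventually_mono)
    then show ?thesis
      by (rule iffD2[OF is_rational_function_cong is_rational_function_const])
  next
    case False
    have "\<forall>\<^sub>\<approx>w. inverse (f w) = poly Q w / poly P w"
      using f(2) by eventually_elim simp
    with False show ?thesis
      by (auto simp: is_rational_function_def)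
  qed
qed

lemma is_rational_function_divide:
  "is_rational_function f \<Longrightarrow> is_rational_function g \<Longrightarrow> is_rational_function (\<lambda>w. f w / g w)"
  unfolding divide_inverse by (intro is_rational_function_mult is_rational_function_inverse)

lemma is_rational_function_affine:
  assumes "is_rational_function f" "c \<noteq> 0"
  shows "is_rational_function (\<lambda>w. f (c * w + d))"
proof -
  obtain P Q where f: "Q \<noteq> 0" "\<forall>\<^sub>\<approx>w. f w = poly P w / poly Q w"
    using assms by (auto simp: is_rational_function_def)
  have "\<forall>\<^sub>\<approx>w. f (c * w + d) = poly (pcompose P [:d, c:]) w / poly (pcompose Q [:d, c:]) w"
    using eventually_cosparse_affine[OF f(2) assms(2), of d]
    by (simp add: poly_pcompose algebra_simps)
  moreover have "pcompose Q [:d, c:] \<noteq> 0"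
    using f(1) assms(2) by (simp add: pcompose_eq_0_iff)
  ultimately show ?thesis
    unfolding is_rational_function_def by blast
qed

lemma is_rational_function_sum:
  "(\<And>i. i \<in> I \<Longrightarrow> is_rational_function (f i)) \<Longrightarrow> is_rational_function (\<lambda>w. \<Sum>i\<in>I. f i w)"
  by (induction I rule: infinite_finite_induct)
     (auto intro: is_rational_function_const is_rational_function_add)

lemma is_rational_function_pochhammer:
  "is_rational_function f \<Longrightarrow> is_rational_function (\<lambda>w. pochhammer (f w) k)"
  by (induction k)
     (auto simp: pochhammer_Suc intro!: is_rational_function_const is_rational_function_mult
       is_rational_function_add)

lemmas is_rational_function_intros =
  is_rational_function_const is_rational_function_id is_rational_function_add
  is_rational_function_mult is_rational_function_divide is_rational_function_sum
  is_rational_function_pochhammer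

text \<open>The exponential factor is entire, so off the finitely many roots of the denominator
  \<open>Q\<close> the function has a finite limit.\<close>

lemma finite_poles_exp_times_rational:
  assumes "is_rational_function R" "\<forall>\<^sub>\<approx>w. f w = exp (\<kappa> * w) * R w"
  shows "finite {w. is_pole f w}"
proof -
  obtain P Q where R: "Q \<noteq> 0" "\<forall>\<^sub>\<approx>w. R w = poly P w / poly Q w"
    using assms by (auto simp: is_rational_function_def)
  have eq: "\<forall>\<^sub>\<approx>w. f w = exp (\<kappa> * w) * (poly P w / poly Q w)"
    using assms(2) R(2) by eventually_elim simp
  have "poly Q w = 0" if "is_pole f w" for w
  proof (rule ccontr)
    assume "poly Q w \<noteq> 0"
    then have "((\<lambda>w. exp (\<kappa> * w) * (poly P w / poly Q w)) \<longlongrightarrow>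
        exp (\<kappa> * w) * (poly P w / poly Q w)) (at w)"
      by (auto intro!: tendsto_intros)
    moreover have "\<forall>\<^sub>F z in at w. f z = exp (\<kappa> * z) * (poly P z / poly Q z)"
      using eq unfolding eventually_cosparse_UNIV by blast
    ultimately have "(f \<longlongrightarrow> exp (\<kappa> * w) * (poly P w / poly Q w)) (at w)"
      by (rule iffD2[OF tendsto_cong, rotated])
    then show False
      using that unfolding is_pole_def
      by (rule not_tendsto_and_filterlim_at_infinity[OF trivial_limit_at])
  qed
  then have "{w. is_pole f w} \<subseteq> {w. poly Q w = 0}"
    by blast
  then show ?thesis
    using R(1) poly_roots_finite finite_subset by blast
qed

text \<open>All elementary solutions below are recognised by this shape: in the quotient of
  consecutive values the exponential contributes only the constant
  \<open>exp \<kappa>\<close>.\<close>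

lemma elementary_exp_times_rational:
  assumes "is_rational_function R" "\<forall>\<^sub>\<approx>w. hyp_fun lam w = exp (\<kappa> * w) * R w"
  shows "elementary_solution lam"
proof -
  have "\<forall>\<^sub>\<approx>w. hyp_fun lam (w + 1) = exp (\<kappa> * (w + 1)) * R (w + 1)"
    using eventually_cosparse_affine[OF assms(2), of 1 1] by simp
  then have "\<forall>\<^sub>\<approx>w. hyp_fun lam (w + 1) / hyp_fun lam w = exp \<kappa> * (R (w + 1) / R w)"
    using assms(2) by eventually_elim (simp add: distrib_left exp_add)
  moreover have "is_rational_function (\<lambda>w. exp \<kappa> * (R (w + 1) / R w))"
    using is_rational_function_affine[OF assms(1), of 1 1] assms(1)
    by (intro is_rational_function_intros) simp_all
  ultimately show ?thesis
    unfolding elementary_solution_def closed_form_solution_def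
    using finite_poles_exp_times_rational[OF assms] by (simp add: is_rational_function_cong)
qed

text \<open>Every set of integers is closed, hence has no accumulation point. With
  \<open>c = r\<close> this discards the points where the series divides by zero.\<close>

lemma cosparse_not_nonpos_Int:
  assumes "c \<noteq> 0"
  shows "\<forall>\<^sub>\<approx>w::complex. c * w \<notin> \<int>\<^sub>\<le>\<^sub>0"
proof -
  have "\<not> w islimpt \<int>\<^sub>\<le>\<^sub>0" for w :: complex
  proof -
    have "\<int>\<^sub>\<le>\<^sub>0 - {w} \<subseteq> \<int>"
      using nonpos_Ints_subset_Ints by blast
    then have "closed (\<int>\<^sub>\<le>\<^sub>0 - {w})"
      by (rule closed_subset_Ints)
    then show ?thesis
      by (simp add: islimpt_in_closure closure_closed)
  qed
  then have "\<forall>\<^sub>\<approx>w::complex. w \<notin> \<int>\<^sub>\<le>\<^sub>0"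
    by (simp add: eventually_cosparse_UNIV islimpt_iff_eventually)
  from eventually_cosparse_affine[OF this assms, of 0] show ?thesis
    by simp
qed

subsection \<open>Convergence and contiguous relations\<close>

text \<open>The term ratio tends to \<open>X\<close> uniformly over parameters bounded by
  \<open>C\<close>. This uniformity gives summability for fixed parameters and later continuity in
  \<open>w\<close>. The bound \<open>real K > C\<close> keeps \<open>\<gamma> + k\<close> away from
  zero for \<open>k \<ge> K\<close>.\<close>

lemma hyp2F1_ratio_bound:
  fixes C X :: real
  assumes "0 \<le> X" "X < 1"
  obtains \<rho> K where "0 < \<rho>" "\<rho> < 1" "real K > C"
    "\<And>k \<alpha> \<beta> \<gamma>. k \<ge> K \<Longrightarrow> norm (\<alpha>::complex) \<le> C \<Longrightarrow> norm (\<beta>::complex) \<le> C \<Longrightarrow>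
      norm (\<gamma>::complex) \<le> C \<Longrightarrow>
      norm ((\<alpha> + of_nat k) * (\<beta> + of_nat k)) * X \<le> \<rho> * norm ((\<gamma> + of_nat k) * (1 + of_nat k))"
proof -
  \<comment> \<open>The midpoint of \<open>X\<close> and 1 is positive and lies strictly above the
    limit of the ratio.\<close>
  define \<rho> where "\<rho> = (1 + X) / 2"
  have "((\<lambda>k. (C + real k)^2 * X / ((real k - C) * (1 + real k))) \<longlongrightarrow> X) sequentially"
    by real_asymp
  then have "eventually (\<lambda>k. (C + real k)^2 * X / ((real k - C) * (1 + real k)) < \<rho>) sequentially"
    using assms by (intro order_tendstoD) (auto simp: \<rho>_def)
  moreover have "eventually (\<lambda>k. real k > C) sequentially"
    by real_asymp
  ultimately have "eventually (\<lambda>k. (C + real k)^2 * X / ((real k - C) * (1 + real k)) < \<rho> \<and> real k > C)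
      sequentially"
    by eventually_elim simp
  then obtain K where K: "\<And>k. k \<ge> K \<Longrightarrow>
      (C + real k)^2 * X / ((real k - C) * (1 + real k)) < \<rho> \<and> real k > C"
    by (auto simp: eventually_sequentially)
  show thesis
  proof (rule that[of \<rho> K])
    fix k and \<alpha> \<beta> \<gamma> :: complex
    assume k: "k \<ge> K" and n: "norm \<alpha> \<le> C" "norm \<beta> \<le> C" "norm \<gamma> \<le> C"
    have "norm (\<alpha> + of_nat k) \<le> C + real k" "norm (\<beta> + of_nat k) \<le> C + real k"
      using n norm_triangle_ineq[of \<alpha> "of_nat k"] norm_triangle_ineq[of \<beta> "of_nat k"] by auto
    then have "norm ((\<alpha> + of_nat k) * (\<beta> + of_nat k)) \<le> (C + real k)^2"
      unfolding norm_mult power2_eq_square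
      by (intro mult_mono) (auto intro: order_trans[OF norm_ge_zero])
    then have "norm ((\<alpha> + of_nat k) * (\<beta> + of_nat k)) * X \<le> (C + real k)^2 * X"
      using assms by (intro mult_right_mono)
    also have "\<dots> \<le> \<rho> * ((real k - C) * (1 + real k))"
      using K[OF k] by (simp add: divide_less_eq split: if_splits)
    also have "real k - C \<le> norm (\<gamma> + of_nat k)"
      using n norm_diff_ineq[of "of_nat k" \<gamma>] by (simp add: add.commute)
    then have "\<rho> * ((real k - C) * (1 + real k)) \<le> \<rho> * norm ((\<gamma> + of_nat k) * (1 + of_nat k))"
      using assms
      by (subst norm_mult, intro mult_left_mono mult_mono)
         (auto simp: \<rho>_def norm_mult simp flip: of_nat_Suc)
    finally show "norm ((\<alpha> + of_nat k) * (\<beta> + of_nat k)) * X \<le>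
      \<rho> * norm ((\<gamma> + of_nat k) * (1 + of_nat k))" .
  qed (use assms K in \<open>auto simp: \<rho>_def\<close>)
qed

lemma hyp2F1_term_Suc:
  "hyp2F1_term \<alpha> \<beta> \<gamma> z (Suc k) =
    hyp2F1_term \<alpha> \<beta> \<gamma> z k * ((\<alpha> + of_nat k) * (\<beta> + of_nat k) / ((\<gamma> + of_nat k) * (1 + of_nat k)) * z)"
  by (simp add: hyp2F1_term_def pochhammer_Suc ac_simps)

lemma summable_hyp2F1_term:
  assumes "norm z < 1"
  shows "summable (hyp2F1_term \<alpha> \<beta> \<gamma> z)"
proof -
  define C where "C = Max {norm \<alpha>, norm \<beta>, norm \<gamma>}"
  have C: "norm \<alpha> \<le> C" "norm \<beta> \<le> C" "norm \<gamma> \<le> C"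
    by (auto simp: C_def)
  obtain \<rho> K where K: "0 < \<rho>" "\<rho> < 1" "real K > C"
    "\<And>k. k \<ge> K \<Longrightarrow> norm ((\<alpha> + of_nat k) * (\<beta> + of_nat k)) * norm z \<le>
        \<rho> * norm ((\<gamma> + of_nat k) * (1 + of_nat k))"
    using hyp2F1_ratio_bound[of "norm z" C] assms C by (metis norm_ge_zero)
  show ?thesis
  proof (rule summable_ratio_test)
    fix k assume "k \<ge> K"
    have "norm \<gamma> < norm (of_nat k :: complex)"
      using C K(3) \<open>k \<ge> K\<close> by simp
    then have "\<gamma> + of_nat k \<noteq> 0"
      by (metis add_eq_0_iff norm_minus_cancel order_less_irrefl)
    moreover have "1 + of_nat k \<noteq> (0::complex)"
      by (simp flip: of_nat_Suc)
    ultimately have "norm ((\<alpha> + of_nat k) * (\<beta> + of_nat k) / ((\<gamma> + of_nat k) * (1 + of_nat k)) * z) \<le> \<rho>"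
      using K(4)[OF \<open>k \<ge> K\<close>] by (simp add: norm_mult norm_divide divide_le_eq)
    then show "norm (hyp2F1_term \<alpha> \<beta> \<gamma> z (Suc k)) \<le> \<rho> * norm (hyp2F1_term \<alpha> \<beta> \<gamma> z k)"
      unfolding hyp2F1_term_Suc norm_mult[of "hyp2F1_term \<alpha> \<beta> \<gamma> z k"]
      by (metis mult.commute mult_left_mono norm_ge_zero)
  qed (rule K(2))
qed

lemma hyp2F1_sums:
  "norm z < 1 \<Longrightarrow> hyp2F1_term \<alpha> \<beta> \<gamma> z sums hyp2F1 \<alpha> \<beta> \<gamma> z"
  unfolding hyp2F1_def by (intro summable_sums summable_hyp2F1_term)

lemma hyp2F1_commute: "hyp2F1 \<alpha> \<beta> \<gamma> z = hyp2F1 \<beta> \<alpha> \<gamma> z"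
  by (simp add: hyp2F1_def hyp2F1_term_def mult.commute)

lemma nonpos_Int_plus_of_nat_nonzero:
  "\<gamma> \<notin> \<int>\<^sub>\<le>\<^sub>0 \<Longrightarrow> \<gamma> + of_nat k \<noteq> (0::complex)"
  by (metis add_eq_0_iff2 minus_of_nat_in_nonpos_Ints)

text \<open>The difference of the Pochhammer symbols of order \<open>k + 1\<close> at
  \<open>\<beta> + 1\<close> and \<open>\<beta>\<close> is \<open>k + 1\<close> times the symbol of
  order \<open>k\<close> at \<open>\<beta> + 1\<close>. The factor \<open>k + 1\<close> cancels
  against the factorial, and the index moves down by one.\<close>

lemma hyp2F1_shift_numerator:
  assumes "norm z < 1"
  shows "hyp2F1 \<alpha> (\<beta> + 1) \<gamma> z - hyp2F1 \<alpha> \<beta> \<gamma> z =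
    \<alpha> / \<gamma> * z * hyp2F1 (\<alpha> + 1) (\<beta> + 1) (\<gamma> + 1) z"
proof -
  let ?d = "\<lambda>k. hyp2F1_term \<alpha> (\<beta> + 1) \<gamma> z k - hyp2F1_term \<alpha> \<beta> \<gamma> z k"
  have "?d (Suc k) = \<alpha> / \<gamma> * z * hyp2F1_term (\<alpha> + 1) (\<beta> + 1) (\<gamma> + 1) z k" for k
  proof -
    have 1: "pochhammer (\<beta> + 1) (Suc k) - pochhammer \<beta> (Suc k) =
        (of_nat k + 1) * pochhammer (\<beta> + 1) k"
      by (subst pochhammer_rec[of \<beta>]) (simp add: pochhammer_Suc algebra_simps)
    have "?d (Suc k) = pochhammer \<alpha> (Suc k) / (pochhammer \<gamma> (Suc k) * pochhammer 1 (Suc k)) *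
        z ^ Suc k * (pochhammer (\<beta> + 1) (Suc k) - pochhammer \<beta> (Suc k))"
      by (simp add: hyp2F1_term_def right_diff_distrib diff_divide_distrib mult_ac)
    also have "\<dots> = pochhammer \<alpha> (Suc k) / (pochhammer \<gamma> (Suc k) * pochhammer 1 (Suc k)) *
        z ^ Suc k * ((of_nat k + 1) * pochhammer (\<beta> + 1) k)"
      unfolding 1 ..
    also have "\<dots> = \<alpha> / \<gamma> * z * hyp2F1_term (\<alpha> + 1) (\<beta> + 1) (\<gamma> + 1) z k"
    proof -
      have "of_nat k + 1 \<noteq> (0::complex)"
        by (metis of_nat_Suc of_nat_neq_0 add.commute)
      then show ?thesis
        unfolding pochhammer_rec[of \<alpha>] pochhammer_rec[of \<gamma>] pochhammer_Suc[of 1] hyp2F1_term_def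
        by (simp add: mult_ac add.commute[of 1])
    qed
    finally show ?thesis .
  qed
  then have "(\<lambda>k. ?d (Suc k)) sums (\<alpha> / \<gamma> * z * hyp2F1 (\<alpha> + 1) (\<beta> + 1) (\<gamma> + 1) z)"
    using hyp2F1_sums[OF assms] by (simp only: sums_mult)
  moreover have "?d 0 = 0"
    by (simp add: hyp2F1_term_def)
  ultimately have "?d sums (\<alpha> / \<gamma> * z * hyp2F1 (\<alpha> + 1) (\<beta> + 1) (\<gamma> + 1) z)"
    using sums_Suc_iff[of ?d] by (simp only: add_0_right)
  moreover have "?d sums (hyp2F1 \<alpha> (\<beta> + 1) \<gamma> z - hyp2F1 \<alpha> \<beta> \<gamma> z)"
    by (intro sums_diff hyp2F1_sums assms)
  ultimately show ?thesis
    using sums_unique2 by blast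
qed

text \<open>Termwise this is the splitting
  \<open>\<gamma> + k = (\<beta> + k) + (\<gamma> - \<beta>)\<close>.\<close>

lemma hyp2F1_shift_denominator:
  assumes "norm z < 1" "\<gamma> \<notin> \<int>\<^sub>\<le>\<^sub>0"
  shows "\<gamma> * hyp2F1 \<alpha> \<beta> \<gamma> z =
    \<beta> * hyp2F1 \<alpha> (\<beta> + 1) (\<gamma> + 1) z + (\<gamma> - \<beta>) * hyp2F1 \<alpha> \<beta> (\<gamma> + 1) z"
proof -
  have "\<gamma> * hyp2F1_term \<alpha> \<beta> \<gamma> z k =
    \<beta> * hyp2F1_term \<alpha> (\<beta> + 1) (\<gamma> + 1) z k + (\<gamma> - \<beta>) * hyp2F1_term \<alpha> \<beta> (\<gamma> + 1) z k" for k
  proof -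
    have nz: "\<gamma> + of_nat k \<noteq> 0" "\<gamma> \<noteq> 0"
      using assms(2) nonpos_Int_plus_of_nat_nonzero by auto
    have "\<gamma> * pochhammer (\<gamma> + 1) k = pochhammer \<gamma> k * (\<gamma> + of_nat k)"
      by (metis pochhammer_Suc pochhammer_rec)
    then have \<gamma>: "pochhammer (\<gamma> + 1) k = pochhammer \<gamma> k * (\<gamma> + of_nat k) / \<gamma>"
      using nz by (simp add: field_simps)
    have \<beta>: "\<beta> * pochhammer (\<beta> + 1) k = pochhammer \<beta> k * (\<beta> + of_nat k)"
      by (metis pochhammer_Suc pochhammer_rec)
    have "\<beta> * hyp2F1_term \<alpha> (\<beta> + 1) (\<gamma> + 1) z k + (\<gamma> - \<beta>) * hyp2F1_term \<alpha> \<beta> (\<gamma> + 1) z k =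
        pochhammer \<alpha> k / (pochhammer (\<gamma> + 1) k * pochhammer 1 k) * z ^ k *
        (\<beta> * pochhammer (\<beta> + 1) k + (\<gamma> - \<beta>) * pochhammer \<beta> k)"
      by (simp add: hyp2F1_term_def distrib_left add_divide_distrib mult_ac)
    also have "\<beta> * pochhammer (\<beta> + 1) k + (\<gamma> - \<beta>) * pochhammer \<beta> k = (\<gamma> + of_nat k) * pochhammer \<beta> k"
      unfolding \<beta> by (simp add: algebra_simps)
    also have "pochhammer \<alpha> k / (pochhammer (\<gamma> + 1) k * pochhammer 1 k) * z ^ k *
        ((\<gamma> + of_nat k) * pochhammer \<beta> k) = \<gamma> * hyp2F1_term \<alpha> \<beta> \<gamma> z k"
      unfolding \<gamma> hyp2F1_term_def using nz by (simp add: mult_ac)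
    finally show ?thesis ..
  qed
  then have "(\<lambda>k. \<gamma> * hyp2F1_term \<alpha> \<beta> \<gamma> z k) sums
    (\<beta> * hyp2F1 \<alpha> (\<beta> + 1) (\<gamma> + 1) z + (\<gamma> - \<beta>) * hyp2F1 \<alpha> \<beta> (\<gamma> + 1) z)"
    using hyp2F1_sums[OF assms(1)] by (simp only: sums_mult sums_add)
  moreover have "(\<lambda>k. \<gamma> * hyp2F1_term \<alpha> \<beta> \<gamma> z k) sums (\<gamma> * hyp2F1 \<alpha> \<beta> \<gamma> z)"
    by (intro sums_mult hyp2F1_sums assms)
  ultimately show ?thesis
    using sums_unique2 by blast
qed

text \<open>Obtained by eliminating the function with all three parameters raised (called
  \<open>?U\<close> up to a factor) from the two preceding relations.\<close>

lemma hyp2F1_shift_mixed: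
  assumes "norm z < 1" "\<gamma> \<notin> \<int>\<^sub>\<le>\<^sub>0"
  shows "hyp2F1 \<alpha> \<beta> \<gamma> z - (1 - z) * hyp2F1 (\<alpha> + 1) \<beta> \<gamma> z =
    z * (\<gamma> - \<beta>) / \<gamma> * hyp2F1 (\<alpha> + 1) \<beta> (\<gamma> + 1) z"
proof -
  have "\<gamma> \<noteq> 0"
    using assms(2) by auto
  let ?U = "\<beta> / \<gamma> * hyp2F1 (\<alpha> + 1) (\<beta> + 1) (\<gamma> + 1) z"
  let ?V = "(\<gamma> - \<beta>) / \<gamma> * hyp2F1 (\<alpha> + 1) \<beta> (\<gamma> + 1) z"
  have 1: "hyp2F1 (\<alpha> + 1) \<beta> \<gamma> z - hyp2F1 \<alpha> \<beta> \<gamma> z = z * ?U"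
    using hyp2F1_shift_numerator[OF assms(1), of \<beta> \<alpha> \<gamma>] by (simp add: hyp2F1_commute mult_ac)
  have 2: "hyp2F1 (\<alpha> + 1) \<beta> \<gamma> z = ?U + ?V"
    using hyp2F1_shift_denominator[OF assms, of "\<alpha> + 1" \<beta>] \<open>\<gamma> \<noteq> 0\<close>
    by (simp add: field_simps)
  have "hyp2F1 \<alpha> \<beta> \<gamma> z - (1 - z) * hyp2F1 (\<alpha> + 1) \<beta> \<gamma> z =
      z * hyp2F1 (\<alpha> + 1) \<beta> \<gamma> z - (hyp2F1 (\<alpha> + 1) \<beta> \<gamma> z - hyp2F1 \<alpha> \<beta> \<gamma> z)"
    by (simp add: left_diff_distrib)
  also have "\<dots> = z * (?U + ?V) - z * ?U"
    by (simp only: 1 flip: 2)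
  finally show ?thesis
    by (simp add: distrib_left mult_ac)
qed

subsection \<open>Degenerate series\<close>

text \<open>The bound \<open>N\<close> depends on \<open>b\<close> alone, so the series is one and
  the same finite sum for all \<open>w\<close>; this makes the terminating case rational in
  \<open>w\<close>.\<close>

lemma hyp2F1_term_eventually_zero:
  assumes "b \<in> \<int>\<^sub>\<le>\<^sub>0"
  shows "\<exists>N. \<forall>\<alpha> \<gamma> z. \<forall>k>N. hyp2F1_term \<alpha> (of_real b) \<gamma> z k = 0"
proof -
  obtain n where n: "b = - of_nat n"
    using assms by (elim nonpos_Ints_cases')
  have "hyp2F1_term \<alpha> (of_real b) \<gamma> z k = 0" if "k > n" for \<alpha> \<gamma> z k
    using pochhammer_of_nat_eq_0_lemma[OF that, where ?'a = complex]
    by (simp add: hyp2F1_term_def n)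
  then show ?thesis
    by blast
qed

lemma is_rational_function_hyp_fun_terminating:
  assumes "b \<in> \<int>\<^sub>\<le>\<^sub>0"
  shows "is_rational_function (hyp_fun (p, 0, r, a, b, x))"
proof -
  obtain N where N: "\<And>\<alpha> \<gamma> z k. k > N \<Longrightarrow> hyp2F1_term \<alpha> (of_real b) \<gamma> z k = 0"
    using hyp2F1_term_eventually_zero[OF assms] by blast
  have "hyp_fun (p, 0, r, a, b, x) = (\<lambda>w. \<Sum>k\<le>N. hyp2F1_term (of_real p * w + of_real a) (of_real b)
      (of_real r * w) (of_real x) k)"
  proof
    fix w
    show "hyp_fun (p, 0, r, a, b, x) w = (\<Sum>k\<le>N. hyp2F1_term (of_real p * w + of_real a) (of_real b)
      (of_real r * w) (of_real x) k)"
      unfolding hyp_fun.simps hyp2F1_def by (simp, rule suminf_finite) (simp_all add: N)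
  qed
  moreover have "is_rational_function \<dots>"
    unfolding hyp2F1_term_def by (intro is_rational_function_intros)
  ultimately show ?thesis
    by simp
qed

lemma gbinomial_pochhammer_power:
  "((- \<alpha>) gchoose k) * (- z) ^ k = pochhammer \<alpha> k / fact k * z ^ (k::nat)" for \<alpha> z :: "'a :: field_char_0"
proof -
  have "(- 1) ^ k * (- z) ^ k = z ^ k"
    by (simp flip: power_mult_distrib)
  then show ?thesis
    by (simp add: gbinomial_pochhammer mult.commute mult.left_commute)
qed

text \<open>Equal upper and lower parameters cancel, which leaves the binomial series.\<close>

lemma hyp2F1_binomial:
  assumes "norm z < 1" "\<gamma> \<notin> \<int>\<^sub>\<le>\<^sub>0"
  shows "hyp2F1 \<alpha> \<gamma> \<gamma> z = (1 - z) powr (- \<alpha>)"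
proof -
  have "pochhammer \<gamma> k \<noteq> 0" for k
    using assms(2) by (metis pochhammer_eq_0_iff minus_of_nat_in_nonpos_Ints)
  then have "hyp2F1_term \<alpha> \<gamma> \<gamma> z = (\<lambda>k. ((- \<alpha>) gchoose k) * (- z) ^ k)"
    by (simp add: hyp2F1_term_def gbinomial_pochhammer_power pochhammer_fact fun_eq_iff)
  moreover have "(\<lambda>k. ((- \<alpha>) gchoose k) * (- z) ^ k) sums (1 + (- z)) powr (- \<alpha>)"
    using assms(1) by (intro gen_binomial_complex) simp
  ultimately show ?thesis
    using hyp2F1_sums[OF assms(1), of \<alpha> \<gamma> \<gamma>] by (simp add: sums_unique2)
qed

text \<open>Equivalent, by Euler's transformation, to a series with a nonpositive integer as a numerator
  parameter. The shift in \<open>n\<close> makes the transformation itself unnecessary.\<close>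

lemma hyp2F1_numerator_exceeds_denominator:
  assumes "norm z < 1"
  shows "\<exists>R. is_rational_function R \<and> (\<forall>w. r * w + c \<notin> \<int>\<^sub>\<le>\<^sub>0 \<longrightarrow>
    hyp2F1 (p * w + a) (r * w + c + of_nat n) (r * w + c) z = (1 - z) powr (- (p * w)) * R w)"
proof (induction n arbitrary: a c)
  case 0
  have "(1 - z) powr (- (p * w + a)) = (1 - z) powr (- (p * w)) * (1 - z) powr (- a)" for w
    by (simp flip: powr_add)
  then show ?case
    using assms is_rational_function_const[of "(1 - z) powr (- a)"] hyp2F1_binomial
    by (intro exI[of _ "\<lambda>_. (1 - z) powr (- a)"]) simp
next
  case (Suc n)
  obtain R where R: "is_rational_function R" "\<And>w. r * w + c \<notin> \<int>\<^sub>\<le>\<^sub>0 \<Longrightarrow>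
    hyp2F1 (p * w + a) (r * w + c + of_nat n) (r * w + c) z = (1 - z) powr (- (p * w)) * R w"
    using Suc[of c a] by blast
  \<comment> \<open>The extra function in the contiguous relation has all parameters raised by one.
    Raising \<open>a\<close> changes only the rational factor: the exponent \<open>- (p * w)\<close>
    does not involve \<open>a\<close>.\<close>
  obtain R' where R': "is_rational_function R'" "\<And>w. r * w + (c + 1) \<notin> \<int>\<^sub>\<le>\<^sub>0 \<Longrightarrow>
    hyp2F1 (p * w + (a + 1)) (r * w + (c + 1) + of_nat n) (r * w + (c + 1)) z = (1 - z) powr (- (p * w)) * R' w"
    using Suc[of "c + 1" "a + 1"] by blast
  define T where "T = (\<lambda>w. R w + (p * w + a) / (r * w + c) * z * R' w)"
  have "hyp2F1 (p * w + a) (r * w + c + of_nat (Suc n)) (r * w + c) z = (1 - z) powr (- (p * w)) * T w"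
    if "r * w + c \<notin> \<int>\<^sub>\<le>\<^sub>0" for w
  proof -
    have "r * w + c + 1 \<notin> \<int>\<^sub>\<le>\<^sub>0"
      using that by (metis add_diff_cancel_right' nonpos_Ints_diff_Nats Nats_1)
    then show ?thesis
      using hyp2F1_shift_numerator[OF assms, of "p * w + a" "r * w + c + of_nat n" "r * w + c"]
        R(2)[OF that] R'(2)[of w]
      by (simp add: T_def algebra_simps)
  qed
  moreover have "is_rational_function T"
    unfolding T_def by (intro is_rational_function_intros R R')
  ultimately show ?case
    by blast
qed

subsection \<open>Products of Bessel polynomials\<close>

text \<open>For \<open>\<alpha> = -n\<close> with \<open>n \<ge> 0\<close> this is the classical
  Bessel polynomial of degree \<open>n\<close>, with its variable multiplied by \<open>-2 u\<close>.
  The upper summation limit exceeds the degree for either sign of \<open>\<alpha>\<close>, so no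
  case distinction enters.\<close>

definition bessel_poly :: "int \<Rightarrow> complex \<Rightarrow> complex poly" where
  "bessel_poly \<alpha> u = (\<Sum>m\<le>nat (\<bar>\<alpha>\<bar> + 1).
     monom (pochhammer (of_int \<alpha>) m * pochhammer (of_int (1 - \<alpha>)) m / fact m * u ^ m) m)"

lemma pochhammer_of_int_eq_0:
  assumes "\<alpha> \<le> 0" "int k > - \<alpha>"
  shows "pochhammer (of_int \<alpha> :: complex) k = 0"
proof -
  have "(of_int \<alpha> :: complex) = - of_nat (nat (- \<alpha>))"
    using assms by simp
  moreover have "nat (- \<alpha>) < k"
    using assms by linarith
  ultimately show ?thesis
    using pochhammer_of_nat_eq_0_lemma by metis
qed

text \<open>One of the integers \<open>\<alpha>\<close> and \<open>1 - \<alpha>\<close> is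
  nonpositive, so its Pochhammer symbol vanishes from some order on.\<close>

lemma pochhammer_mult_reflected_eq_0:
  assumes "m > nat (\<bar>\<alpha>\<bar> + 1)"
  shows "pochhammer (of_int \<alpha> :: complex) m * pochhammer (of_int (1 - \<alpha>)) m = 0"
proof (cases "\<alpha> \<le> 0")
  case True
  then show ?thesis
    using assms pochhammer_of_int_eq_0[of \<alpha> m] by simp
next
  case False
  then show ?thesis
    using assms pochhammer_of_int_eq_0[of "1 - \<alpha>" m] by simp
qed

lemma coeff_bessel_poly:
  "coeff (bessel_poly \<alpha> u) m = pochhammer (of_int \<alpha>) m * pochhammer (of_int (1 - \<alpha>)) m / fact m * u ^ m"
  using pochhammer_mult_reflected_eq_0[of \<alpha> m]
  by (auto simp: bessel_poly_def coeff_sum not_le)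

lemma bessel_poly_0: "bessel_poly 0 u = 1"
  by (auto simp: poly_eq_iff coeff_bessel_poly pochhammer_0_left)

lemma bessel_poly_reflect: "bessel_poly (1 - \<alpha>) u = bessel_poly \<alpha> u"
  by (auto simp: poly_eq_iff coeff_bessel_poly)

text \<open>Compared coefficientwise: at degree \<open>k + 1\<close> every polynomial involved has a
  simple multiple of the coefficient \<open>?a\<close> of degree \<open>k\<close>.\<close>

lemma bessel_poly_derivative_down:
  "smult (2 * u) (pCons 0 (pCons 0 (pderiv (bessel_poly \<alpha> u)))) =
     smult (2 * of_int (\<alpha> - 1) * u) (pCons 0 (bessel_poly \<alpha> u)) + bessel_poly \<alpha> u - bessel_poly (\<alpha> - 1) u"
proof (rule poly_eqI)
  fix m
  show "coeff (smult (2 * u) (pCons 0 (pCons 0 (pderiv (bessel_poly \<alpha> u))))) m =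
     coeff (smult (2 * of_int (\<alpha> - 1) * u) (pCons 0 (bessel_poly \<alpha> u)) + bessel_poly \<alpha> u - bessel_poly (\<alpha> - 1) u) m"
  proof (cases m)
    case 0
    then show ?thesis
      by (simp add: coeff_bessel_poly)
  next
    case (Suc k)
    let ?\<alpha> = "of_int \<alpha> :: complex"
    let ?a = "coeff (bessel_poly \<alpha> u) k"
    have nz: "of_nat k + 1 \<noteq> (0 :: complex)"
      by (metis of_nat_Suc of_nat_neq_0 add.commute)
    have 1: "coeff (pCons 0 (pCons 0 (pderiv (bessel_poly \<alpha> u)))) m = of_nat k * ?a"
      using Suc by (cases k) (simp_all add: coeff_pderiv)
    have 2: "coeff (bessel_poly \<alpha> u) m = ?a * ((?\<alpha> + of_nat k) * (1 - ?\<alpha> + of_nat k) * u) / (of_nat k + 1)"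
      unfolding Suc coeff_bessel_poly by (simp add: pochhammer_Suc mult_ac add.commute[of 1])
    \<comment> \<open>The leading factor \<open>?\<alpha> - 1\<close> of the first symbol is moved,
      with its sign changed, in front of the second, where it completes a Pochhammer symbol at
      \<open>1 - ?\<alpha>\<close>.\<close>
    have "pochhammer (?\<alpha> - 1) (Suc k) * pochhammer (2 - ?\<alpha>) (Suc k) =
        - (pochhammer ?\<alpha> k * ((1 - ?\<alpha>) * pochhammer (1 - ?\<alpha> + 1) (Suc k)))"
      by (simp add: pochhammer_rec[of "?\<alpha> - 1"] algebra_simps)
    also have "(1 - ?\<alpha>) * pochhammer (1 - ?\<alpha> + 1) (Suc k) =
        pochhammer (1 - ?\<alpha>) k * (1 - ?\<alpha> + of_nat k) * (1 - ?\<alpha> + of_nat (Suc k))"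
      using pochhammer_rec[of "1 - ?\<alpha>" "Suc k"] pochhammer_Suc[of "1 - ?\<alpha>" "Suc k"]
        pochhammer_Suc[of "1 - ?\<alpha>" k]
      by (simp only:)
    also have "1 - ?\<alpha> + of_nat (Suc k) = 2 - ?\<alpha> + of_nat k"
      by simp
    finally have "pochhammer (?\<alpha> - 1) (Suc k) * pochhammer (2 - ?\<alpha>) (Suc k) =
        - (pochhammer ?\<alpha> k * (pochhammer (1 - ?\<alpha>) k * (1 - ?\<alpha> + of_nat k) * (2 - ?\<alpha> + of_nat k)))" .
    then have 3: "coeff (bessel_poly (\<alpha> - 1) u) m =
        - (?a * ((1 - ?\<alpha> + of_nat k) * (2 - ?\<alpha> + of_nat k) * u) / (of_nat k + 1))"
      unfolding Suc coeff_bessel_poly by (simp add: mult_ac add.commute[of 1])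
    have "((?\<alpha> + of_nat k) * (1 - ?\<alpha> + of_nat k) * u) / (of_nat k + 1) +
        ((1 - ?\<alpha> + of_nat k) * (2 - ?\<alpha> + of_nat k) * u) / (of_nat k + 1) = 2 * u * (1 - ?\<alpha> + of_nat k)"
      using nz by (simp add: add_divide_distrib[symmetric] divide_eq_eq) (simp add: algebra_simps)
    then have "?a * (((?\<alpha> + of_nat k) * (1 - ?\<alpha> + of_nat k) * u) / (of_nat k + 1)) +
        ?a * (((1 - ?\<alpha> + of_nat k) * (2 - ?\<alpha> + of_nat k) * u) / (of_nat k + 1)) =
        ?a * (2 * u * (1 - ?\<alpha> + of_nat k))"
      by (simp only: flip: distrib_left)
    then have 4: "coeff (bessel_poly \<alpha> u) m - coeff (bessel_poly (\<alpha> - 1) u) m = ?a * (2 * u * (1 - ?\<alpha> + of_nat k))"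
      by (simp only: 2 3 diff_minus_eq_add times_divide_eq_right)
    have 5: "coeff (smult (2 * of_int (\<alpha> - 1) * u) (pCons 0 (bessel_poly \<alpha> u)) + bessel_poly \<alpha> u -
        bessel_poly (\<alpha> - 1) u) m =
        2 * (?\<alpha> - 1) * u * ?a + (coeff (bessel_poly \<alpha> u) m - coeff (bessel_poly (\<alpha> - 1) u) m)"
      by (simp add: Suc)
    show ?thesis
      unfolding 5 4 coeff_smult 1 by (simp add: algebra_simps)
  qed
qed

text \<open>The preceding relation at \<open>1 - \<alpha>\<close>, since the polynomials are
  invariant under \<open>\<alpha> \<mapsto> 1 - \<alpha>\<close>.\<close>

lemma bessel_poly_derivative_up:
  "smult (2 * u) (pCons 0 (pCons 0 (pderiv (bessel_poly \<alpha> u)))) =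
     smult (- 2 * of_int \<alpha> * u) (pCons 0 (bessel_poly \<alpha> u)) + bessel_poly \<alpha> u - bessel_poly (\<alpha> + 1) u"
  using bessel_poly_derivative_down[of u "1 - \<alpha>"] bessel_poly_reflect[of \<alpha>] bessel_poly_reflect[of "\<alpha> + 1"]
  by simp

section \<open>The linear functional that introduces Pochhammer denominators\<close>

definition pochhammer_functional :: "complex \<Rightarrow> complex poly \<Rightarrow> complex" where
  "pochhammer_functional w p = (\<Sum>m\<le>degree p. coeff p m / pochhammer w m)"

lemma pochhammer_functional_altdef:
  assumes "degree p \<le> n"
  shows "pochhammer_functional w p = (\<Sum>m\<le>n. coeff p m / pochhammer w m)"
  unfolding pochhammer_functional_def
  by (rule sum.mono_neutral_left) (use assms in \<open>auto simp: coeff_eq_0\<close>)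

lemma pochhammer_functional_add:
  "pochhammer_functional w (p + q) = pochhammer_functional w p + pochhammer_functional w q"
proof -
  let ?n = "max (degree p) (degree q)"
  have "degree (p + q) \<le> ?n"
    by (rule degree_add_le_max)
  then show ?thesis
    by (simp add: pochhammer_functional_altdef[of _ ?n] add_divide_distrib sum.distrib)
qed

lemma pochhammer_functional_smult:
  "pochhammer_functional w (smult c p) = c * pochhammer_functional w p"
  by (simp add: pochhammer_functional_altdef[of "smult c p" "degree p"] degree_smult_le
      pochhammer_functional_def sum_distrib_left)

lemma pochhammer_functional_diff:
  "pochhammer_functional w (p - q) = pochhammer_functional w p - pochhammer_functional w q"
  using pochhammer_functional_add[of w "p - q" q] by simp

lemma pochhammer_functional_1: "pochhammer_functional w 1 = 1"
  by (simp add: pochhammer_functional_def)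

text \<open>Multiplication by the variable becomes the shift \<open>w \<mapsto> w + 1\<close>,
  because the symbol of order \<open>m + 1\<close> at \<open>w\<close> is \<open>w\<close> times the
  symbol of order \<open>m\<close> at \<open>w + 1\<close>.\<close>

lemma pochhammer_functional_pCons:
  "pochhammer_functional w (pCons 0 p) = pochhammer_functional (w + 1) p / w"
proof -
  have "pochhammer_functional w (pCons 0 p) = (\<Sum>m\<le>Suc (degree p). coeff (pCons 0 p) m / pochhammer w m)"
    by (intro pochhammer_functional_altdef) (rule degree_pCons_le)
  also have "\<dots> = (\<Sum>m\<le>degree p. coeff p m / pochhammer w (Suc m))"
    by (subst sum.atMost_Suc_shift) simp
  also have "\<dots> = (\<Sum>m\<le>degree p. coeff p m / pochhammer (w + 1) m / w)"
    by (simp add: pochhammer_rec mult.commute)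
  finally show ?thesis
    by (simp add: pochhammer_functional_def sum_divide_distrib)
qed

text \<open>The functional is the formal counterpart of an inverse Laplace transform (the monomial of
  degree \<open>m\<close> stands for \<open>\<sigma> powr (-m)\<close>), and this is the corresponding integration by parts.\<close>

lemma pochhammer_functional_parts:
  assumes "w \<notin> \<int>\<^sub>\<le>\<^sub>0"
  shows "pochhammer_functional w (pCons 0 (pCons 0 (pderiv p))) =
    pochhammer_functional w p - w * pochhammer_functional w (pCons 0 p)"
proof -
  let ?n = "degree p"
  let ?q = "pCons 0 (pCons 0 (pderiv p))"
  have coeff: "coeff ?q (Suc m) = of_nat m * coeff p m" for m
    by (cases m) (simp_all add: coeff_pderiv)
  have "degree ?q \<le> Suc ?n"
  proof (rule degree_le, intro allI impI)
    fix i assume "i > Suc ?n"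
    then obtain j where "i = Suc j" "j > ?n"
      by (cases i) auto
    then show "coeff ?q i = 0"
      using coeff[of j] by (simp add: coeff_eq_0)
  qed
  then have "pochhammer_functional w ?q = (\<Sum>m\<le>?n. of_nat m * coeff p m / pochhammer w (Suc m))"
    by (subst pochhammer_functional_altdef[of _ "Suc ?n"])
       (simp_all only: sum.atMost_Suc_shift coeff, simp)
  moreover have "pochhammer_functional w (pCons 0 p) = (\<Sum>m\<le>?n. coeff p m / pochhammer w (Suc m))"
    by (subst pochhammer_functional_altdef[of _ "Suc ?n"])
       (simp_all only: sum.atMost_Suc_shift degree_pCons_le, simp)
  \<comment> \<open>The numerators add up to \<open>w + m\<close>, the last factor of the symbol of
    order \<open>m + 1\<close>.\<close>
  moreover have "of_nat m * coeff p m / pochhammer w (Suc m) + w * (coeff p m / pochhammer w (Suc m)) =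
      coeff p m / pochhammer w m" for m
  proof -
    have nz: "w + of_nat m \<noteq> 0"
      using assms nonpos_Int_plus_of_nat_nonzero by blast
    have "of_nat m * coeff p m / pochhammer w (Suc m) + w * (coeff p m / pochhammer w (Suc m)) =
      (coeff p m * (w + of_nat m)) / (pochhammer w m * (w + of_nat m))"
      by (simp add: pochhammer_Suc add_divide_distrib[symmetric] algebra_simps)
    also have "\<dots> = coeff p m / pochhammer w m"
      using nz by simp
    finally show ?thesis .
  qed
  ultimately show ?thesis
    by (simp add: pochhammer_functional_def sum_distrib_left eq_diff_eq flip: sum.distrib)
qed

lemma pochhammer_functional_sum:
  "pochhammer_functional w (\<Sum>i\<in>I. p i) = (\<Sum>i\<in>I. pochhammer_functional w (p i))"
  by (induction I rule: infinite_finite_induct)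
     (simp_all add: pochhammer_functional_add, simp_all add: pochhammer_functional_def)

lemma pochhammer_functional_monom:
  "pochhammer_functional w (monom c m) = c / pochhammer w m"
  by (subst pochhammer_functional_altdef[of _ m])
     (simp_all add: degree_monom_le if_distrib[of "\<lambda>t. t / _"] cong: if_cong)

lemma pochhammer_functional_bessel_product:
  "pochhammer_functional w (bessel_poly \<alpha> u * bessel_poly \<beta> v) =
     (\<Sum>i\<le>nat (\<bar>\<alpha>\<bar> + 1). \<Sum>j\<le>nat (\<bar>\<beta>\<bar> + 1).
        pochhammer (of_int \<alpha>) i * pochhammer (of_int \<beta>) j *
        pochhammer (of_int (1 - \<alpha>)) i * pochhammer (of_int (1 - \<beta>)) j /
        (pochhammer w (i + j) * fact i * fact j) * u ^ i * v ^ j)"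
  by (simp add: bessel_poly_def sum_product mult_monom pochhammer_functional_sum pochhammer_functional_monom mult_ac)

text \<open>All terms outside a finite rectangle vanish, so the infinite sum is a finite one
  whatever the size of \<open>u\<close> and \<open>v\<close>.\<close>

lemma appell_F3_reflected:
  "appell_F3 (of_int \<alpha>) (of_int \<beta>) (of_int (1 - \<alpha>)) (of_int (1 - \<beta>)) w u v =
     pochhammer_functional w (bessel_poly \<alpha> u * bessel_poly \<beta> v)"
proof -
  let ?t = "\<lambda>(i, j). pochhammer (of_int \<alpha>) i * pochhammer (of_int \<beta>) j *
        pochhammer (of_int (1 - \<alpha>)) i * pochhammer (of_int (1 - \<beta>)) j /
        (pochhammer w (i + j) * fact i * fact j) * u ^ i * v ^ j"
  let ?A = "{..nat (\<bar>\<alpha>\<bar> + 1)} \<times> {..nat (\<bar>\<beta>\<bar> + 1)}"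
  have "?t ij = 0" if "ij \<notin> ?A" for ij
    using that pochhammer_mult_reflected_eq_0[of \<alpha> "fst ij"] pochhammer_mult_reflected_eq_0[of \<beta> "snd ij"]
    by (cases ij) auto
  then have "infsum ?t UNIV = infsum ?t ?A"
    by (intro infsum_cong_neutral) auto
  also have "\<dots> = sum ?t ?A"
    by (intro infsum_finite) auto
  finally show ?thesis
    unfolding appell_F3_def pochhammer_functional_bessel_product sum.cartesian_product .
qed

text \<open>The product rule, the derivative relations of the two factors and integration by parts
  are combined. The weights \<open>1 / (2 * u)\<close> and \<open>1 / (2 * v)\<close> normalise the
  derivatives; as they sum to 1, the terms with the unshifted product at \<open>w\<close>
  cancel.\<close>

lemma bessel_product_up_up:
  assumes "w \<notin> \<int>\<^sub>\<le>\<^sub>0" "u \<noteq> 0" "v \<noteq> 0" "1 / (2 * u) + 1 / (2 * v) = 1"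
  shows "(w - of_int \<alpha> - of_int \<beta>) / w * pochhammer_functional (w + 1) (bessel_poly \<alpha> u * bessel_poly \<beta> v) =
    1 / (2 * u) * pochhammer_functional w (bessel_poly (\<alpha> + 1) u * bessel_poly \<beta> v) +
    1 / (2 * v) * pochhammer_functional w (bessel_poly \<alpha> u * bessel_poly (\<beta> + 1) v)"
proof -
  define A where "A = bessel_poly \<alpha> u"
  define B where "B = bessel_poly \<beta> v"
  define A' where "A' = bessel_poly (\<alpha> + 1) u"
  define B' where "B' = bessel_poly (\<beta> + 1) v"
  let ?L = "pochhammer_functional w"
  let ?\<tau> = "\<lambda>p. pCons (0 :: complex) p"
  have "pderiv (A * B) = pderiv A * B + A * pderiv B"
    by (simp add: pderiv_mult mult.commute)
  then have "?\<tau> (?\<tau> (pderiv (A * B))) =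
      smult (1 / (2 * u)) (smult (2 * u) (?\<tau> (?\<tau> (pderiv A))) * B) +
      smult (1 / (2 * v)) (A * smult (2 * v) (?\<tau> (?\<tau> (pderiv B))))"
    using assms(2,3) by (simp add: mult_pCons_left mult_pCons_right)
  also have "\<dots> = smult (1 / (2 * u)) (smult (- 2 * of_int \<alpha> * u) (?\<tau> (A * B)) + A * B - A' * B) +
      smult (1 / (2 * v)) (smult (- 2 * of_int \<beta> * v) (?\<tau> (A * B)) + A * B - A * B')"
    unfolding A_def B_def A'_def B'_def bessel_poly_derivative_up
    by (simp add: algebra_simps mult_pCons_left mult_pCons_right)
  finally have "?L (A * B) - w * ?L (?\<tau> (A * B)) =
      1 / (2 * u) * (- 2 * of_int \<alpha> * u * ?L (?\<tau> (A * B)) + ?L (A * B) - ?L (A' * B)) +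
      1 / (2 * v) * (- 2 * of_int \<beta> * v * ?L (?\<tau> (A * B)) + ?L (A * B) - ?L (A * B'))"
    using pochhammer_functional_parts[OF assms(1), of "A * B"]
    by (simp only: pochhammer_functional_add pochhammer_functional_smult pochhammer_functional_diff)
  also have "\<dots> = (1 / (2 * u) + 1 / (2 * v)) * ?L (A * B) - (of_int \<alpha> + of_int \<beta>) * ?L (?\<tau> (A * B)) -
      1 / (2 * u) * ?L (A' * B) - 1 / (2 * v) * ?L (A * B')"
    using assms(2,3) by (simp add: field_simps)
  finally have "(w - of_int \<alpha> - of_int \<beta>) * ?L (?\<tau> (A * B)) =
      1 / (2 * u) * ?L (A' * B) + 1 / (2 * v) * ?L (A * B')"
    unfolding assms(4) by (simp add: algebra_simps)
  then show ?thesis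
    unfolding pochhammer_functional_pCons A_def B_def A'_def B'_def by simp
qed

text \<open>The previous relation at \<open>1 - \<alpha>\<close>, read through the reflection
  symmetry.\<close>

lemma bessel_product_down_up:
  assumes "w \<notin> \<int>\<^sub>\<le>\<^sub>0" "u \<noteq> 0" "v \<noteq> 0" "1 / (2 * u) + 1 / (2 * v) = 1"
  shows "(w + of_int \<alpha> - 1 - of_int \<beta>) / w * pochhammer_functional (w + 1) (bessel_poly \<alpha> u * bessel_poly \<beta> v) =
    1 / (2 * u) * pochhammer_functional w (bessel_poly (\<alpha> - 1) u * bessel_poly \<beta> v) +
    1 / (2 * v) * pochhammer_functional w (bessel_poly \<alpha> u * bessel_poly (\<beta> + 1) v)"
  using bessel_product_up_up[OF assms, of "1 - \<alpha>" \<beta>] bessel_poly_reflect[of \<alpha>] bessel_poly_reflect[of "\<alpha> - 1"]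
  by (simp add: algebra_simps)

text \<open>The series and its closed form, as functions of \<open>\<alpha> = i + j\<close> and \<open>\<beta> = j - i\<close>, satisfy the same
  two contiguous relations. These determine all values from those at \<open>\<alpha> = \<beta> = 0\<close>.\<close>

lemma contiguous_relations_unique:
  fixes X :: "complex \<Rightarrow> int \<Rightarrow> int \<Rightarrow> complex"
  assumes base: "\<And>w. w \<notin> \<int>\<^sub>\<le>\<^sub>0 \<Longrightarrow> X w 0 0 = 0"
    and reflect: "\<And>w \<alpha> \<beta>. X w \<alpha> (1 - \<beta>) = X w \<alpha> \<beta>"
    and up: "\<And>w \<alpha> \<beta>. w \<notin> \<int>\<^sub>\<le>\<^sub>0 \<Longrightarrow> X w \<alpha> (\<beta> + 1) - d * X w (\<alpha> + 1) \<beta> = k w \<alpha> \<beta> * X (w + 1) \<alpha> \<beta>"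
    and down: "\<And>w \<alpha> \<beta>. w \<notin> \<int>\<^sub>\<le>\<^sub>0 \<Longrightarrow> X w \<alpha> (\<beta> + 1) - X w (\<alpha> - 1) \<beta> = l w \<alpha> \<beta> * X (w + 1) \<alpha> \<beta>"
    and "d \<noteq> 0" "w \<notin> \<int>\<^sub>\<le>\<^sub>0"
  shows "X w \<alpha> \<beta> = 0"
proof -
  have Suc: "w + 1 \<notin> \<int>\<^sub>\<le>\<^sub>0" if "w \<notin> \<int>\<^sub>\<le>\<^sub>0" for w :: complex
    using that by (metis add_diff_cancel_right' nonpos_Ints_diff_Nats Nats_1)
  \<comment> \<open>At \<open>\<beta> = 0\<close> reflection identifies \<open>\<beta> + 1\<close>
    with \<open>\<beta>\<close>, so both relations become recursions in \<open>\<alpha>\<close>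
    alone. They are solved upwards by \<open>up\<close>, where \<open>d\<close> is divided out, and
    downwards by \<open>down\<close>.\<close>
  have \<beta>0: "\<forall>w. w \<notin> \<int>\<^sub>\<le>\<^sub>0 \<longrightarrow> X w \<alpha> 0 = 0" for \<alpha>
  proof (induction \<alpha> rule: int_induct[where k = 0])
    case (step1 \<alpha>)
    then show ?case
      using up[of _ \<alpha> 0] reflect[of _ \<alpha> 0] Suc \<open>d \<noteq> 0\<close> by auto
  next
    case (step2 \<alpha>)
    then show ?case
      using down[of _ \<alpha> 0] reflect[of _ \<alpha> 0] Suc by auto
  qed (simp add: base)
  \<comment> \<open>The relation \<open>down\<close> raises \<open>\<beta>\<close>, given the
    vanishing at the current \<open>\<beta>\<close> for all \<open>w\<close> and
    \<open>\<alpha>\<close> at once.\<close>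
  have nonneg: "\<forall>w \<alpha>. w \<notin> \<int>\<^sub>\<le>\<^sub>0 \<longrightarrow> X w \<alpha> (int n) = 0" for n
  proof (induction n)
    case (Suc n)
    then show ?case
      using down[of _ _ "int n"] \<open>\<And>w. w \<notin> \<int>\<^sub>\<le>\<^sub>0 \<Longrightarrow> w + 1 \<notin> \<int>\<^sub>\<le>\<^sub>0\<close> by (simp add: add.commute)
  qed (simp add: \<beta>0)
  show ?thesis
  proof (cases "\<beta> \<ge> 0")
    case True
    then show ?thesis
      using nonneg[of "nat \<beta>"] assms by simp
  next
    case False
    then show ?thesis
      using nonneg[of "nat (1 - \<beta>)"] reflect[of w \<alpha> \<beta>] assms by simp
  qed
qed

subsection \<open>The quadratic transformation\<close>

text \<open>\<open>Re z < 1\<close> keeps \<open>1 - z\<close> off the branch cut, and the principal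
  root has nonnegative real part, so adding 1 to it also stays off the cut.\<close>

lemma csqrt_one_minus_neighbourhood:
  assumes "norm z < 1"
  shows "1 - z \<notin> \<real>\<^sub>\<le>\<^sub>0" "(1 + csqrt (1 - z)) / 2 \<notin> \<real>\<^sub>\<le>\<^sub>0" "csqrt (1 - z) \<noteq> 0"
    "1 + csqrt (1 - z) \<noteq> 0"
proof -
  have "Re z < 1"
    using assms complex_Re_le_cmod[of z] by linarith
  then show 1: "1 - z \<notin> \<real>\<^sub>\<le>\<^sub>0"
    by (auto simp: complex_nonpos_Reals_iff)
  then show "csqrt (1 - z) \<noteq> 0"
    by auto
  define s where "s = csqrt (1 - z)"
  have "Re s \<ge> 0"
    using csqrt_principal[of "1 - z"] unfolding s_def by linarith
  then have "(1 + s) / 2 \<notin> \<real>\<^sub>\<le>\<^sub>0" "1 + s \<noteq> 0"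
    by (auto simp: complex_nonpos_Reals_iff complex_eq_iff)
  then show "(1 + csqrt (1 - z)) / 2 \<notin> \<real>\<^sub>\<le>\<^sub>0" "1 + csqrt (1 - z) \<noteq> 0"
    by (simp_all only: s_def not_False_eq_True)
qed

text \<open>Here \<open>R\<close> is a square root of \<open>1 - X\<close>. Applying the operator
  \<open>2 X d/dX + \<kappa>\<close> once more to the first-order equation \<open>RH\<close> and
  multiplying by \<open>R\<close> eliminates \<open>R\<close>, by means of
  \<open>R * R = 1 - X\<close> and its derivative \<open>2 R R' = -1\<close>.\<close>

lemma fps_quadratic_ODE:
  fixes R G H :: "complex fps"
  assumes RR: "R * R = 1 - fps_X"
    and H: "H = 2 * fps_X * fps_deriv G + fps_const \<kappa> * G"
    and RH: "R * H = fps_const \<kappa> * G"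
  shows "(1 - fps_X) * (2 * fps_X * fps_deriv H + fps_const \<kappa> * H) - fps_X * H = fps_const (\<kappa>\<^sup>2) * G"
proof -
  have 1: "2 * (R * fps_deriv R) = - 1"
    using arg_cong[OF RR, of fps_deriv] by (simp add: mult.commute)
  have 2: "fps_deriv R * H + R * fps_deriv H = fps_const \<kappa> * fps_deriv G"
    using arg_cong[OF RH, of fps_deriv] by (simp add: mult.commute add.commute)
  have "(1 - fps_X) * (2 * fps_X * fps_deriv H + fps_const \<kappa> * H) - fps_X * H =
      (1 - fps_X) * (2 * fps_X * fps_deriv H + fps_const \<kappa> * H) + fps_X * H * (2 * (R * fps_deriv R))"
    by (simp add: 1)
  also have "\<dots> = R * (2 * fps_X * (fps_deriv R * H + R * fps_deriv H) + fps_const \<kappa> * (R * H))"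
    unfolding RR[symmetric] by (simp add: algebra_simps)
  also have "\<dots> = R * (fps_const \<kappa> * (2 * fps_X * fps_deriv G + fps_const \<kappa> * G))"
    unfolding 2 RH by (simp add: algebra_simps)
  also have "\<dots> = fps_const \<kappa> * (R * H)"
    unfolding H by (simp add: algebra_simps)
  also have "\<dots> = fps_const (\<kappa>\<^sup>2) * G"
    unfolding RH by (simp add: power2_eq_square flip: fps_const_mult mult.assoc)
  finally show ?thesis .
qed

text \<open>The operator \<open>2 X d/dX + \<kappa>\<close> multiplies the coefficient of degree
  \<open>m\<close> by \<open>2 m + \<kappa>\<close>, so the differential equation becomes a two-term
  recursion.\<close>

lemma fps_nth_quadratic_ODE:
  fixes G H :: "complex fps"
  assumes ODE: "(1 - fps_X) * (2 * fps_X * fps_deriv H + fps_const \<kappa> * H) - fps_X * H = fps_const (\<kappa>\<^sup>2) * G"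
    and H: "H = 2 * fps_X * fps_deriv G + fps_const \<kappa> * G"
  shows "((2 * of_nat (Suc n) + \<kappa>)\<^sup>2 - \<kappa>\<^sup>2) * fps_nth G (Suc n) =
    (2 * of_nat n + \<kappa> + 1) * (2 * of_nat n + \<kappa>) * fps_nth G n"
proof -
  have D: "fps_nth (2 * fps_X * fps_deriv F + fps_const \<kappa> * F) m = (2 * of_nat m + \<kappa>) * fps_nth F m"
    for F :: "complex fps" and m
    by (cases m) (simp_all add: algebra_simps numeral_fps_const)
  have "fps_nth ((1 - fps_X) * K - fps_X * H) (Suc n) = fps_nth K (Suc n) - fps_nth K n - fps_nth H n" for K
    by (simp add: left_diff_distrib)
  from this[of "2 * fps_X * fps_deriv H + fps_const \<kappa> * H"]
  have "(2 * of_nat (Suc n) + \<kappa>) * fps_nth H (Suc n) - (2 * of_nat n + \<kappa>) * fps_nth H n - fps_nth H n =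
      \<kappa>\<^sup>2 * fps_nth G (Suc n)"
    unfolding ODE D by simp
  moreover have "fps_nth H m = (2 * of_nat m + \<kappa>) * fps_nth G m" for m
    unfolding H by (rule D)
  ultimately show ?thesis
    by (simp add: algebra_simps power2_eq_square)
qed

text \<open>The right-hand side \<open>g\<close> satisfies
  \<open>sqrt (1 - z) * (2 z g' + \<kappa> g) = \<kappa> g\<close> with
  \<open>\<kappa> = w - 1\<close>. The resulting coefficient recursion is the one of the
  hypergeometric terms, and both start with 1.\<close>

lemma hyp2F1_quadratic:
  assumes w: "w \<notin> \<int>\<^sub>\<le>\<^sub>0" and z: "norm z < 1"
  shows "hyp2F1 (w / 2) ((w - 1) / 2) w z = ((1 + csqrt (1 - z)) / 2) powr (1 - w)"
proof -
  define S where "S = (\<lambda>z. csqrt (1 - z))"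
  define g where "g = (\<lambda>z. ((1 + S z) / 2) powr (1 - w))"
  define \<kappa> where "\<kappa> = w - 1"
  note nbhd = csqrt_one_minus_neighbourhood[folded S_def]
  have S': "(S has_field_derivative - 1 / (2 * S z)) (at z)" if "norm z < 1" for z
    unfolding S_def by (auto intro!: derivative_eq_intros csqrt_one_minus_neighbourhood that)
  have g': "(g has_field_derivative \<kappa> / (2 * S z * (1 + S z)) * g z) (at z)" if "norm z < 1" for z
  proof -
    let ?c = "(1 + S z) / 2"
    have c: "?c \<notin> \<real>\<^sub>\<le>\<^sub>0"
      using nbhd(2)[OF that] by (simp add: S_def)
    have nz: "S z \<noteq> 0" "1 + S z \<noteq> 0"
      using nbhd(3,4)[OF that] by (simp_all add: S_def)
    have "(g has_field_derivative (1 - w) * ?c powr (1 - w - 1) * (- 1 / (2 * S z) / 2)) (at z)"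
      unfolding g_def using c by (auto intro!: derivative_eq_intros S' that)
    also have "?c powr (1 - w - 1) = g z / ?c"
      unfolding g_def using nz by (subst powr_diff) simp
    also have "(1 - w) * (g z / ?c) * (- 1 / (2 * S z) / 2) = \<kappa> / (2 * S z * (1 + S z)) * g z"
      using nz by (simp add: \<kappa>_def divide_simps) (simp add: algebra_simps)
    finally show ?thesis .
  qed
  have holg: "g holomorphic_on ball 0 1" and holS: "S holomorphic_on ball 0 1"
    unfolding holomorphic_on_open[OF open_ball] using g' S' by (metis mem_ball_0)+
  define G where "G = fps_expansion g 0"
  define R where "R = fps_expansion S 0"
  have G: "g has_fps_expansion G" and R: "S has_fps_expansion R"
    unfolding G_def R_def using holg holS
    by (auto intro!: has_fps_expansion_fps_expansion[of "ball 0 1"])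
  have ev: "\<forall>\<^sub>F z in nhds 0. norm (z :: complex) < 1"
    using eventually_nhds_in_open[of "ball 0 1" "0::complex"] by simp
  have RR: "R * R = 1 - fps_X"
  proof -
    have "(\<lambda>z. S z * S z) has_fps_expansion R * R"
      by (intro fps_expansion_intros R)
    moreover have "(\<lambda>z. S z * S z) = (\<lambda>z. 1 - z)"
      by (simp add: S_def fun_eq_iff flip: power2_eq_square)
    moreover have "(\<lambda>z::complex. 1 - z) has_fps_expansion 1 - fps_X"
      by (intro fps_expansion_intros)
    ultimately show ?thesis
      using fps_expansion_unique_complex by metis
  qed
  define H where "H = 2 * fps_X * fps_deriv G + fps_const \<kappa> * G"
  have RH: "R * H = fps_const \<kappa> * G"
  proof -
    have RHexp: "(\<lambda>z. S z * (2 * z * deriv g z + \<kappa> * g z)) has_fps_expansion R * H"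
      unfolding H_def by (intro fps_expansion_intros R G)
    \<comment> \<open>The logarithmic derivative of \<open>g\<close> brings in
      \<open>z / (1 + S z)\<close>, which equals \<open>1 - S z\<close> because
      \<open>z = 1 - (S z)^2\<close>.\<close>
    have "\<forall>\<^sub>F z in nhds 0. S z * (2 * z * deriv g z + \<kappa> * g z) = \<kappa> * g z"
      using ev
    proof eventually_elim
      case (elim z)
      have nz: "S z \<noteq> 0" "1 + S z \<noteq> 0"
        using nbhd(3,4)[OF elim] by (simp_all add: S_def)
      have "z = (1 - S z) * (1 + S z)"
        by (simp add: S_def algebra_simps flip: power2_eq_square)
      then have 1: "z / (1 + S z) = 1 - S z"
        using nz by (simp add: field_simps)
      have "S z * (2 * z * (\<kappa> / (2 * S z * (1 + S z)) * g z)) = \<kappa> * g z * (z / (1 + S z))"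
        using nz(1) by simp
      then show ?case
        unfolding DERIV_imp_deriv[OF g'[OF elim]] distrib_left 1 by (simp only:) (simp add: algebra_simps)
    qed
    then have "(\<lambda>z. \<kappa> * g z) has_fps_expansion R * H"
      by (rule iffD1[OF has_fps_expansion_cong[OF _ refl] RHexp])
    moreover have "(\<lambda>z. \<kappa> * g z) has_fps_expansion fps_const \<kappa> * G"
      by (intro fps_expansion_intros G)
    ultimately show ?thesis
      by (rule fps_expansion_unique_complex)
  qed
  note rec = fps_nth_quadratic_ODE[OF fps_quadratic_ODE[OF RR H_def RH] H_def]
  have coeff: "fps_nth G n * z ^ n = hyp2F1_term (w / 2) ((w - 1) / 2) w z n" for n
  proof (induction n)
    case 0
    have "fps_nth G 0 = 1"
      using has_fps_expansion_imp_0_eq_fps_nth_0[OF G] by (simp add: g_def S_def)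
    then show ?case
      by (simp add: hyp2F1_term_def)
  next
    case (Suc n)
    have "(2 * of_nat (Suc n) + \<kappa>)\<^sup>2 - \<kappa>\<^sup>2 = 4 * ((w + of_nat n) * (1 + of_nat n))"
      by (simp add: \<kappa>_def algebra_simps power2_eq_square)
    moreover have "(2 * of_nat n + \<kappa> + 1) * (2 * of_nat n + \<kappa>) = 4 * ((w / 2 + of_nat n) * ((w - 1) / 2 + of_nat n))"
      by (simp add: \<kappa>_def field_simps)
    ultimately have "4 * ((w + of_nat n) * (1 + of_nat n)) * fps_nth G (Suc n) =
        4 * ((w / 2 + of_nat n) * ((w - 1) / 2 + of_nat n)) * fps_nth G n"
      using rec[of n] by (simp only:)
    moreover have "(w + of_nat n) * (1 + of_nat n) \<noteq> 0"
      using w nonpos_Int_plus_of_nat_nonzero[of w n] of_nat_neq_0[of n, where ?'a = complex] by simp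
    moreover have "X = Y * (B / A)" if "4 * A * X = 4 * B * Y" "A \<noteq> 0" for A B X Y :: complex
      using that by (simp add: field_simps)
    ultimately have "fps_nth G (Suc n) = fps_nth G n *
        ((w / 2 + of_nat n) * ((w - 1) / 2 + of_nat n) / ((w + of_nat n) * (1 + of_nat n)))"
      by blast
    then show ?case
      unfolding hyp2F1_term_Suc Suc[symmetric] by simp
  qed
  \<comment> \<open>As \<open>g\<close> is holomorphic on the whole unit disc, its expansion at 0
    represents it at \<open>z\<close>, not merely near 0.\<close>
  have "(\<lambda>n. fps_nth G n * z ^ n) sums g z"
    using holomorphic_power_series[OF holg, of z] z
    by (simp add: G_def fps_expansion_def)
  then show ?thesis
    using hyp2F1_sums[OF z, of "w / 2" "(w - 1) / 2" w] unfolding coeff g_def S_def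
    by (rule sums_unique2[symmetric])
qed

subsection \<open>Dihedral hypergeometric functions\<close>

text \<open>With \<open>\<alpha> = i + j\<close> and \<open>\<beta> = j - i\<close> the numerator
  parameters are \<open>w / 2 + i\<close> and \<open>(w - 1) / 2 + j\<close>.\<close>

definition dihedral_hyp2F1 :: "complex \<Rightarrow> complex \<Rightarrow> int \<Rightarrow> int \<Rightarrow> complex" where
  "dihedral_hyp2F1 z w \<alpha> \<beta> =
     hyp2F1 ((w + of_int \<alpha> - of_int \<beta>) / 2) ((w - 1 + of_int \<alpha> + of_int \<beta>) / 2) w z"

text \<open>The number \<open>s\<close> stands for the square root of \<open>1 - z\<close>.\<close>

definition dihedral_closed_form :: "complex \<Rightarrow> complex \<Rightarrow> int \<Rightarrow> int \<Rightarrow> complex" where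
  "dihedral_closed_form s w \<alpha> \<beta> = s powi (- \<alpha>) * ((1 + s) / 2) powr (1 - w) *
     pochhammer_functional w (bessel_poly \<alpha> (- ((1 - s) / (2 * s))) * bessel_poly \<beta> ((1 - s) / 2))"

text \<open>Reflection of \<open>\<beta>\<close> interchanges the numerator parameters. In terms of
  \<open>A\<close> and \<open>B\<close> below, the other two identities are instances of
  \<open>hyp2F1_shift_mixed\<close> and \<open>hyp2F1_shift_numerator\<close>.\<close>

lemma dihedral_hyp2F1_contiguous:
  fixes w z :: complex and \<alpha> \<beta> :: int
  defines "H \<equiv> dihedral_hyp2F1 z"
  assumes "norm z < 1" "w \<notin> \<int>\<^sub>\<le>\<^sub>0"
  shows "\<And>w. H w \<alpha> (1 - \<beta>) = H w \<alpha> \<beta>"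
    and "H w \<alpha> (\<beta> + 1) - (1 - z) * H w (\<alpha> + 1) \<beta> =
      z * (w - of_int \<alpha> - of_int \<beta>) / (2 * w) * H (w + 1) \<alpha> \<beta>"
    and "H w \<alpha> (\<beta> + 1) - H w (\<alpha> - 1) \<beta> =
      z * (w + of_int \<alpha> - 1 - of_int \<beta>) / (2 * w) * H (w + 1) \<alpha> \<beta>"
proof -
  have "(w + of_int \<alpha> - of_int (1 - \<beta>)) / 2 = (w - 1 + of_int \<alpha> + of_int \<beta>) / 2"
    "(w - 1 + of_int \<alpha> + of_int (1 - \<beta>)) / 2 = (w + of_int \<alpha> - of_int \<beta>) / 2" for w :: complex
    by (simp_all add: field_simps)
  then show "H w \<alpha> (1 - \<beta>) = H w \<alpha> \<beta>" for w
    unfolding H_def dihedral_hyp2F1_def by (metis hyp2F1_commute)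
  define A where "A = (w + of_int \<alpha> - of_int \<beta> - 1) / 2"
  define B where "B = (w + of_int \<alpha> + of_int \<beta>) / 2"
  have H: "H w \<alpha> (\<beta> + 1) = hyp2F1 A B w z" "H w (\<alpha> + 1) \<beta> = hyp2F1 (A + 1) B w z"
    "H w (\<alpha> - 1) \<beta> = hyp2F1 A (B - 1) w z"
    "H (w + 1) \<alpha> \<beta> = hyp2F1 (A + 1) B (w + 1) z"
    unfolding H_def dihedral_hyp2F1_def A_def B_def
    by (rule arg_cong2[where f = "\<lambda>a b. hyp2F1 a b _ z"]; simp add: field_simps)+
  show "H w \<alpha> (\<beta> + 1) - (1 - z) * H w (\<alpha> + 1) \<beta> =
      z * (w - of_int \<alpha> - of_int \<beta>) / (2 * w) * H (w + 1) \<alpha> \<beta>"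
    unfolding H hyp2F1_shift_mixed[OF assms(2,3)] by (simp add: B_def field_simps)
  have "z * (w + of_int \<alpha> - 1 - of_int \<beta>) / (2 * w) = A / w * z"
    by (simp add: A_def field_simps)
  then show "H w \<alpha> (\<beta> + 1) - H w (\<alpha> - 1) \<beta> =
      z * (w + of_int \<alpha> - 1 - of_int \<beta>) / (2 * w) * H (w + 1) \<alpha> \<beta>"
    unfolding H using hyp2F1_shift_numerator[OF assms(2), of A "B - 1" w] by simp
qed

text \<open>These are the Bessel product relations after the prefactors are restored: a step in
  \<open>\<alpha>\<close> costs a power of \<open>s\<close>, and a step in \<open>w\<close> a factor
  \<open>c = (1 + s) / 2\<close>.\<close>

lemma dihedral_closed_form_contiguous:
  fixes w s :: complex and \<alpha> \<beta> :: int
  defines "R \<equiv> dihedral_closed_form s"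
  assumes "w \<notin> \<int>\<^sub>\<le>\<^sub>0" "s \<noteq> 0" "s \<noteq> 1" "s \<noteq> - 1"
  shows "\<And>w. R w \<alpha> (1 - \<beta>) = R w \<alpha> \<beta>"
    and "R w \<alpha> (\<beta> + 1) - s\<^sup>2 * R w (\<alpha> + 1) \<beta> =
      (1 - s\<^sup>2) * (w - of_int \<alpha> - of_int \<beta>) / (2 * w) * R (w + 1) \<alpha> \<beta>"
    and "R w \<alpha> (\<beta> + 1) - R w (\<alpha> - 1) \<beta> =
      (1 - s\<^sup>2) * (w + of_int \<alpha> - 1 - of_int \<beta>) / (2 * w) * R (w + 1) \<alpha> \<beta>"
proof -
  define c where "c = (1 + s) / 2"
  define u where "u = - ((1 - s) / (2 * s))"
  define v where "v = (1 - s) / 2"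
  have "1 - s \<noteq> 0" "c \<noteq> 0"
    using assms(4,5) by (auto simp: c_def add_eq_0_iff)
  have nz: "u \<noteq> 0" "v \<noteq> 0"
    using assms(3,4) by (auto simp: u_def v_def)
  have "2 * u = - ((1 - s) / s)" "2 * v = 1 - s"
    using assms(3) by (simp_all add: u_def v_def field_simps)
  then have uv: "1 / (2 * u) = - (s / (1 - s))" "1 / (2 * v) = 1 / (1 - s)"
    by simp_all
  have one: "1 / (2 * u) + 1 / (2 * v) = 1"
    unfolding uv using \<open>1 - s \<noteq> 0\<close> by (simp add: field_simps)
  define L where "L = (\<lambda>w \<alpha> \<beta>. pochhammer_functional w (bessel_poly \<alpha> u * bessel_poly \<beta> v))"
  have R: "R w \<alpha> \<beta> = s powi (- \<alpha>) * c powr (1 - w) * L w \<alpha> \<beta>" for w \<alpha> \<beta>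
    by (simp add: R_def dihedral_closed_form_def L_def u_def v_def c_def)
  show "R w \<alpha> (1 - \<beta>) = R w \<alpha> \<beta>" for w
    by (simp add: R_def dihedral_closed_form_def bessel_poly_reflect)
  have powr: "c powr (1 - w) = c * c powr (- w)"
    using \<open>c \<noteq> 0\<close> by (simp add: powr_diff powr_minus field_simps)
  have c: "(1 - s) * c = (1 - s\<^sup>2) / 2"
    by (simp add: c_def power2_eq_square algebra_simps)
  \<comment> \<open>Multiplying a Bessel relation by \<open>1 - s\<close> clears its denominators;
    together with the factor \<open>c\<close> released by the step to \<open>w + 1\<close> this
    gives \<open>(1 - s) * c = (1 - s^2) / 2\<close>.\<close>
  have combine: "s powi (- \<alpha>) * c powr (1 - w) * M - s powi (- \<alpha>) * c powr (1 - w) * (s * M') =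
      (1 - s\<^sup>2) * \<mu> / (2 * w) * R (w + 1) \<alpha> \<beta>"
    if "\<mu> / w * L (w + 1) \<alpha> \<beta> = - (s / (1 - s)) * M' + 1 / (1 - s) * M" for M M' \<mu>
  proof -
    have "M - s * M' = t * (- (s / t) * M' + 1 / t * M)" if "t \<noteq> 0" for t
      using that by (simp add: field_simps)
    then have "M - s * M' = (1 - s) * (\<mu> / w * L (w + 1) \<alpha> \<beta>)"
      unfolding that using \<open>1 - s \<noteq> 0\<close> by blast
    then have "s powi (- \<alpha>) * c powr (1 - w) * (M - s * M') =
        s powi (- \<alpha>) * c powr (- w) * (((1 - s) * c) * (\<mu> / w * L (w + 1) \<alpha> \<beta>))"
      unfolding powr by simp
    also have "\<dots> = (1 - s\<^sup>2) * \<mu> / (2 * w) * R (w + 1) \<alpha> \<beta>"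
      unfolding c R by simp
    finally show ?thesis
      by (simp only: right_diff_distrib)
  qed
  have "- (\<alpha> + 1) = - \<alpha> - 1" "- (\<alpha> - 1) = - \<alpha> + 1"
    by simp_all
  then have powi: "s powi (- (\<alpha> + 1)) * s\<^sup>2 = s powi (- \<alpha>) * s" "s powi (- (\<alpha> - 1)) = s powi (- \<alpha>) * s"
    using \<open>s \<noteq> 0\<close>
    by (simp_all only: power_int_diff power_int_add simp_thms) (simp_all add: power2_eq_square)
  have "s\<^sup>2 * R w (\<alpha> + 1) \<beta> = (s powi (- (\<alpha> + 1)) * s\<^sup>2) * c powr (1 - w) * L w (\<alpha> + 1) \<beta>"
    by (simp only: R mult_ac)
  also have "\<dots> = s powi (- \<alpha>) * c powr (1 - w) * (s * L w (\<alpha> + 1) \<beta>)"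
    unfolding powi by (simp only: mult_ac)
  finally show "R w \<alpha> (\<beta> + 1) - s\<^sup>2 * R w (\<alpha> + 1) \<beta> =
      (1 - s\<^sup>2) * (w - of_int \<alpha> - of_int \<beta>) / (2 * w) * R (w + 1) \<alpha> \<beta>"
    unfolding R[of w \<alpha> "\<beta> + 1"]
    using bessel_product_up_up[OF assms(2) nz one, of \<alpha> \<beta>] unfolding uv
    by (simp only: combine L_def)
  have "R w (\<alpha> - 1) \<beta> = s powi (- \<alpha>) * c powr (1 - w) * (s * L w (\<alpha> - 1) \<beta>)"
    unfolding R powi by (simp only: mult_ac)
  then show "R w \<alpha> (\<beta> + 1) - R w (\<alpha> - 1) \<beta> =
      (1 - s\<^sup>2) * (w + of_int \<alpha> - 1 - of_int \<beta>) / (2 * w) * R (w + 1) \<alpha> \<beta>"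
    unfolding R[of w \<alpha> "\<beta> + 1"]
    using bessel_product_down_up[OF assms(2) nz one, of \<alpha> \<beta>] unfolding uv
    by (simp only: combine L_def)
qed

text \<open>The difference of both sides satisfies the linear relations of
  \<open>contiguous_relations_unique\<close> and vanishes at \<open>\<alpha> = \<beta> = 0\<close>
  by the quadratic transformation.\<close>

lemma hyp2F1_dihedral:
  fixes x :: real and w :: complex
  assumes x: "- 1 < x" "x < 1" "x \<noteq> 0" and w: "w \<notin> \<int>\<^sub>\<le>\<^sub>0"
  shows "hyp2F1 ((w + of_int \<alpha> - of_int \<beta>) / 2) ((w - 1 + of_int \<alpha> + of_int \<beta>) / 2) w (of_real x) =
    of_real (sqrt (1 - x)) powi (- \<alpha>) * of_real ((1 + sqrt (1 - x)) / 2) powr (1 - w) *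
    pochhammer_functional w
      (bessel_poly \<alpha> (of_real (- ((1 - sqrt (1 - x)) / (2 * sqrt (1 - x))))) *
       bessel_poly \<beta> (of_real ((1 - sqrt (1 - x)) / 2)))"
proof -
  define s where "s = complex_of_real (sqrt (1 - x))"
  let ?c = "(1 + s) / 2"
  define \<sigma> where "\<sigma> = sqrt (1 - x)"
  \<comment> \<open>Here \<open>x \<noteq> 0\<close> excludes \<open>s = 1\<close>, for which both
    arguments of the Bessel polynomials would be zero.\<close>
  have "\<sigma> > 0" "\<sigma> \<noteq> 1"
    using x by (auto simp: \<sigma>_def)
  then have s: "s \<noteq> 0" "s \<noteq> 1" "s \<noteq> - 1"
    by (auto simp: s_def complex_eq_iff simp flip: \<sigma>_def)
  have s2: "s\<^sup>2 = 1 - of_real x"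
    using x by (simp add: s_def flip: of_real_power)
  then have xs: "complex_of_real x = 1 - s\<^sup>2"
    by simp
  have norm: "norm (1 - s\<^sup>2) < 1"
    using x by (simp flip: xs)
  define H where "H = dihedral_hyp2F1 (1 - s\<^sup>2)"
  define R where "R = dihedral_closed_form s"
  note Hrel = dihedral_hyp2F1_contiguous[OF norm, folded H_def]
  note Rrel = dihedral_closed_form_contiguous[OF _ s, folded R_def]
  have "csqrt (of_real (1 - x)) = s"
    unfolding s_def using x by (intro csqrt_of_real) simp
  then have "csqrt (1 - of_real x) = s"
    by simp
  then have base: "H w 0 0 = R w 0 0" if "w \<notin> \<int>\<^sub>\<le>\<^sub>0" for w
    using hyp2F1_quadratic[OF that norm]
    by (simp add: H_def R_def dihedral_hyp2F1_def dihedral_closed_form_def bessel_poly_0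
        pochhammer_functional_1 flip: xs)
  have rel: "(H w \<alpha> (\<beta> + 1) - R w \<alpha> (\<beta> + 1)) - d * (H w' \<alpha>' \<beta> - R w' \<alpha>' \<beta>) = k * (H w'' \<alpha> \<beta> - R w'' \<alpha> \<beta>)"
    if "H w \<alpha> (\<beta> + 1) - d * H w' \<alpha>' \<beta> = k * H w'' \<alpha> \<beta>"
      "R w \<alpha> (\<beta> + 1) - d * R w' \<alpha>' \<beta> = k * R w'' \<alpha> \<beta>" for w w' w'' d k \<alpha> \<alpha>' \<beta>
    using that by (simp add: algebra_simps)
  have "H w \<alpha> \<beta> - R w \<alpha> \<beta> = 0"
  proof (rule contiguous_relations_unique[where X = "\<lambda>w \<alpha> \<beta>. H w \<alpha> \<beta> - R w \<alpha> \<beta>" and d = "s\<^sup>2"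
      and k = "\<lambda>w \<alpha> \<beta>. (1 - s\<^sup>2) * (w - of_int \<alpha> - of_int \<beta>) / (2 * w)"
      and l = "\<lambda>w \<alpha> \<beta>. (1 - s\<^sup>2) * (w + of_int \<alpha> - 1 - of_int \<beta>) / (2 * w)"])
    show "H w 0 0 - R w 0 0 = 0" if "w \<notin> \<int>\<^sub>\<le>\<^sub>0" for w
      using base[OF that] by simp
    show "(H w \<alpha> (\<beta> + 1) - R w \<alpha> (\<beta> + 1)) - s\<^sup>2 * (H w (\<alpha> + 1) \<beta> - R w (\<alpha> + 1) \<beta>) =
        (1 - s\<^sup>2) * (w - of_int \<alpha> - of_int \<beta>) / (2 * w) * (H (w + 1) \<alpha> \<beta> - R (w + 1) \<alpha> \<beta>)"
      if "w \<notin> \<int>\<^sub>\<le>\<^sub>0" for w \<alpha> \<beta>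
      using Hrel(2)[OF that] Rrel(2)[OF that] by (intro rel) simp_all
    show "(H w \<alpha> (\<beta> + 1) - R w \<alpha> (\<beta> + 1)) - (H w (\<alpha> - 1) \<beta> - R w (\<alpha> - 1) \<beta>) =
        (1 - s\<^sup>2) * (w + of_int \<alpha> - 1 - of_int \<beta>) / (2 * w) * (H (w + 1) \<alpha> \<beta> - R (w + 1) \<alpha> \<beta>)"
      if "w \<notin> \<int>\<^sub>\<le>\<^sub>0" for w \<alpha> \<beta>
      using rel[of w \<alpha> \<beta> 1 w "\<alpha> - 1" "(1 - s\<^sup>2) * (w + of_int \<alpha> - 1 - of_int \<beta>) / (2 * w)" "w + 1"]
        Hrel(3)[OF that, of \<alpha> \<beta>] Rrel(3)[OF that, of \<alpha> \<beta>]
      by (simp only: mult_1_left)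
    show "H w \<alpha> (1 - \<beta>) - R w \<alpha> (1 - \<beta>) = H w \<alpha> \<beta> - R w \<alpha> \<beta>" for w \<alpha> \<beta>
      using Hrel(1)[OF w] Rrel(1)[OF w] by simp
  qed (use s w in auto)
  then show ?thesis
    by (simp add: H_def R_def dihedral_hyp2F1_def dihedral_closed_form_def s_def xs)
qed

subsection \<open>Poles\<close>

lemma summable_binomial_coeffs:
  fixes \<beta> x :: real
  assumes "\<bar>x\<bar> < 1"
  shows "summable (\<lambda>k. \<bar>((- \<beta>) gchoose k) * (- x) ^ k\<bar>)"
proof -
  obtain y where y: "\<bar>x\<bar> < y" "y < 1"
    using assms dense by blast
  then have "summable (\<lambda>k. ((- \<beta>) gchoose k) * y ^ k)"
    using gen_binomial_real[of y "- \<beta>"] by (auto simp: sums_iff)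
  from powser_insidea[OF this, of "- x"] y show ?thesis
    by simp
qed

text \<open>These moments of the beta weight turn the binomial coefficients into hypergeometric ones
  under integration.\<close>

lemma Beta_shift_left:
  fixes \<alpha> \<delta> :: real
  assumes "0 < \<alpha>" "0 < \<delta>"
  shows "Beta (\<alpha> + of_nat k) \<delta> = Beta \<alpha> \<delta> * (pochhammer \<alpha> k / pochhammer (\<alpha> + \<delta>) k)"
proof -
  have "\<alpha> \<notin> \<int>\<^sub>\<le>\<^sub>0" "\<alpha> + \<delta> \<notin> \<int>\<^sub>\<le>\<^sub>0"
    using assms by (auto dest: nonpos_Ints_nonpos)
  moreover have "Gamma \<alpha> > 0" "Gamma (\<alpha> + \<delta>) > 0"
    using assms by (simp_all add: Gamma_real_pos)
  ultimately show ?thesis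
    by (simp add: Beta_def pochhammer_Gamma add_ac)
qed

text \<open>By Euler's integral the series is a positive multiple of the integral of
  \<open>(1 - x t) powr (-\<beta>)\<close> against a beta weight. Only the partial sums of the binomial series need to
  be integrated, since they are uniformly bounded below by a positive number.\<close>

lemma hyp2F1_real_nonzero:
  fixes \<alpha> \<beta> \<gamma> x :: real
  assumes "0 < \<alpha>" "\<alpha> < \<gamma>" "\<bar>x\<bar> < 1"
  shows "hyp2F1 (of_real \<alpha>) (of_real \<beta>) (of_real \<gamma>) (of_real x) \<noteq> 0"
proof -
  define \<delta> where "\<delta> = \<gamma> - \<alpha>"
  have \<delta>: "\<delta> > 0" "\<gamma> = \<alpha> + \<delta>"
    using assms by (auto simp: \<delta>_def)
  define c where "c = (\<lambda>k. ((- \<beta>) gchoose k) * (- x) ^ k)"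
  define S where "S = (\<lambda>K t. \<Sum>k<K. c k * t ^ k)"
  define T where "T = (\<lambda>k. c k * (pochhammer \<alpha> k / pochhammer \<gamma> k))"
  have "x * t < 1" if "t \<in> {0..1}" for t
  proof -
    have "x * t \<le> \<bar>x\<bar> * t"
      using that by (intro mult_right_mono) auto
    also have "\<dots> \<le> \<bar>x\<bar> * 1"
      using that by (intro mult_left_mono) auto
    finally show ?thesis
      using assms by simp
  qed
  note less_1 = this
  then have "continuous_on {0..1} (\<lambda>t. (1 - x * t) powr (- \<beta>))"
    by (intro continuous_intros) force+
  then obtain t0 where t0: "t0 \<in> {0..1}" "\<And>t. t \<in> {0..1} \<Longrightarrow>
      (1 - x * t0) powr (- \<beta>) \<le> (1 - x * t) powr (- \<beta>)"
    using continuous_attains_inf[of "{0..1::real}" "\<lambda>t. (1 - x * t) powr (- \<beta>)"] by auto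
  \<comment> \<open>The minimum over the unit interval of the limit function. Uniform convergence up
    to \<open>m / 2\<close> then keeps the partial sums above \<open>m / 2\<close>.\<close>
  define m where "m = (1 - x * t0) powr (- \<beta>)"
  have "m > 0"
    using less_1[OF t0(1)] by (simp add: m_def)
  have lim: "(\<lambda>k. c k * t ^ k) sums (1 - x * t) powr (- \<beta>)" if "t \<in> {0..1}" for t
  proof -
    have "\<bar>- (x * t)\<bar> \<le> \<bar>x\<bar> * 1"
      unfolding abs_minus_cancel abs_mult using that by (intro mult_left_mono) auto
    then have "\<bar>- (x * t)\<bar> < 1"
      using assms by linarith
    then have "(\<lambda>k. ((- \<beta>) gchoose k) * (- (x * t)) ^ k) sums (1 + - (x * t)) powr (- \<beta>)"
      by (rule gen_binomial_real)
    moreover have "(- (x * t)) ^ k = (- x) ^ k * t ^ k" for k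
      by (metis mult_minus_left power_mult_distrib)
    ultimately show ?thesis
      by (simp only: c_def mult.assoc add_uminus_conv_diff)
  qed
  have "uniform_limit {0..1} (\<lambda>K t. \<Sum>k<K. c k * t ^ k) (\<lambda>t. \<Sum>k. c k * t ^ k) sequentially"
  proof (rule Weierstrass_m_test)
    show "norm (c k * t ^ k) \<le> \<bar>c k\<bar>" if "t \<in> {0..1}" for k t
      using that by (simp add: abs_mult mult_left_le power_le_one)
    show "summable (\<lambda>k. \<bar>c k\<bar>)"
      by (simp only: c_def summable_binomial_coeffs[OF assms(3)])
  qed
  then have "\<forall>\<^sub>F K in sequentially. \<forall>t\<in>{0..1}. dist (S K t) (\<Sum>k. c k * t ^ k) < m / 2"
    unfolding S_def using \<open>m > 0\<close> by (intro uniform_limitD) auto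
  then have "\<forall>\<^sub>F K in sequentially. m / 2 \<le> (\<Sum>k<K. T k)"
  proof eventually_elim
    case (elim K)
    have S: "m / 2 \<le> S K t" if "t \<in> {0..1}" for t
    proof -
      have "(\<Sum>k. c k * t ^ k) = (1 - x * t) powr (- \<beta>)"
        using lim[OF that] by (simp add: sums_iff)
      moreover have "dist (S K t) (\<Sum>k. c k * t ^ k) < m / 2"
        using elim that by blast
      moreover have "m \<le> (1 - x * t) powr (- \<beta>)"
        using t0(2)[OF that] by (simp add: m_def)
      ultimately show ?thesis
        unfolding dist_real_def by linarith
    qed
    let ?\<omega> = "\<lambda>t. t powr (\<alpha> - 1) * (1 - t) powr (\<delta> - 1)"
    have "((\<lambda>t. \<Sum>k<K. c k * (t powr (\<alpha> + of_nat k - 1) * (1 - t) powr (\<delta> - 1))) has_integral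
        (\<Sum>k<K. c k * Beta (\<alpha> + of_nat k) \<delta>)) {0..1}"
      using assms \<delta> by (intro has_integral_sum has_integral_mult_right has_integral_Beta_real) auto
    also have "(\<Sum>k<K. c k * Beta (\<alpha> + of_nat k) \<delta>) = Beta \<alpha> \<delta> * (\<Sum>k<K. T k)"
      using assms \<delta> by (simp add: Beta_shift_left T_def sum_distrib_left mult_ac)
    finally have 1: "((\<lambda>t. \<Sum>k<K. c k * (t powr (\<alpha> + of_nat k - 1) * (1 - t) powr (\<delta> - 1))) has_integral
        Beta \<alpha> \<delta> * (\<Sum>k<K. T k)) {0..1}" .
    have 2: "((\<lambda>t. m / 2 * ?\<omega> t) has_integral m / 2 * Beta \<alpha> \<delta>) {0..1}"
      using assms \<delta> by (intro has_integral_mult_right has_integral_Beta_real) auto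
    have "m / 2 * Beta \<alpha> \<delta> \<le> Beta \<alpha> \<delta> * (\<Sum>k<K. T k)"
    proof (rule has_integral_le[OF 2 1])
      fix t :: real assume t: "t \<in> {0..1}"
      have powr: "t powr (\<alpha> + of_nat k - 1) = t ^ k * t powr (\<alpha> - 1)" for k
        using t by (cases "t = 0") (auto simp: powr_add[symmetric] powr_realpow[symmetric] algebra_simps)
      have "(\<Sum>k<K. c k * (t powr (\<alpha> + of_nat k - 1) * (1 - t) powr (\<delta> - 1))) = S K t * ?\<omega> t"
        unfolding powr S_def sum_distrib_right by (simp only: mult_ac)
      also have "S K t * ?\<omega> t \<ge> m / 2 * ?\<omega> t"
        using S[OF t] by (intro mult_right_mono) auto
      finally show "m / 2 * ?\<omega> t \<le> (\<Sum>k<K. c k * (t powr (\<alpha> + of_nat k - 1) * (1 - t) powr (\<delta> - 1)))" .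
    qed
    moreover have "Beta \<alpha> \<delta> > 0"
      using assms \<delta> by (simp add: Beta_def Gamma_real_pos)
    ultimately show ?case
      by (simp add: mult.commute)
  qed
  moreover have term_eq: "hyp2F1_term (of_real \<alpha>) (of_real \<beta>) (of_real \<gamma>) (of_real x) k = of_real (T k)" for k
  proof -
    have "c k = pochhammer \<beta> k / fact k * x ^ k"
      by (simp add: c_def gbinomial_pochhammer flip: power_mult_distrib)
    then show ?thesis
      by (simp add: hyp2F1_term_def T_def pochhammer_of_real mult_ac flip: pochhammer_fact)
  qed
  have "summable (\<lambda>k. complex_of_real (T k))"
    using summable_hyp2F1_term[of "of_real x" "of_real \<alpha>" "of_real \<beta>" "of_real \<gamma>"] assms(3)
    by (simp add: term_eq[abs_def])
  then have "summable T"
    by (rule summable_of_real_iff[THEN iffD1])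
  then have "(\<lambda>K. \<Sum>k<K. T k) \<longlonglongrightarrow> suminf T"
    by (rule summable_LIMSEQ)
  ultimately have "m / 2 \<le> suminf T"
    by (intro tendsto_lowerbound) auto
  moreover have "hyp2F1 (of_real \<alpha>) (of_real \<beta>) (of_real \<gamma>) (of_real x) = of_real (suminf T)"
    unfolding hyp2F1_def term_eq using \<open>summable T\<close> by (rule suminf_of_real[symmetric])
  ultimately show ?thesis
    using \<open>m > 0\<close> by simp
qed

text \<open>Dividing the series by \<open>Gamma \<gamma>\<close> turns its denominators into values
  of the entire function \<open>rGamma\<close>, so the terms stay meaningful at nonpositive integers
  \<open>\<gamma>\<close>.\<close>

definition hyp2F1_regularized_term :: "complex \<Rightarrow> complex \<Rightarrow> complex \<Rightarrow> complex \<Rightarrow> nat \<Rightarrow> complex" where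
  "hyp2F1_regularized_term \<alpha> \<beta> \<gamma> z k =
     pochhammer \<alpha> k * pochhammer \<beta> k * rGamma (\<gamma> + of_nat k) / fact k * z ^ k"

lemma hyp2F1_eq_Gamma_mult:
  assumes "norm z < 1" "\<gamma> \<notin> \<int>\<^sub>\<le>\<^sub>0"
  shows "hyp2F1 \<alpha> \<beta> \<gamma> z = Gamma \<gamma> * (\<Sum>k. hyp2F1_regularized_term \<alpha> \<beta> \<gamma> z k)"
proof -
  have "rGamma \<gamma> \<noteq> 0"
    using assms by (simp add: rGamma_eq_zero_iff)
  have "hyp2F1_regularized_term \<alpha> \<beta> \<gamma> z k = rGamma \<gamma> * hyp2F1_term \<alpha> \<beta> \<gamma> z k" for k
  proof -
    have "pochhammer \<gamma> k \<noteq> 0"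
      using assms(2) by (metis pochhammer_eq_0_iff minus_of_nat_in_nonpos_Ints)
    then have "rGamma (\<gamma> + of_nat k) = rGamma \<gamma> / pochhammer \<gamma> k"
      using pochhammer_rGamma[of \<gamma> k] by simp
    then show ?thesis
      by (simp add: hyp2F1_regularized_term_def hyp2F1_term_def pochhammer_fact)
  qed
  then have "(\<Sum>k. hyp2F1_regularized_term \<alpha> \<beta> \<gamma> z k) = rGamma \<gamma> * hyp2F1 \<alpha> \<beta> \<gamma> z"
    unfolding hyp2F1_def using summable_hyp2F1_term[OF assms(1)] by (simp add: suminf_mult)
  then show ?thesis
    using \<open>rGamma \<gamma> \<noteq> 0\<close> by (simp add: Gamma_def)
qed

text \<open>The first \<open>n + 1\<close> terms vanish with \<open>rGamma\<close>. The remaining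
  ones, reindexed, form a hypergeometric series again, with denominator parameter
  \<open>n + 2\<close>.\<close>

lemma hyp2F1_regularized_nonpos_Int:
  assumes "norm z < 1"
  shows "(\<Sum>k. hyp2F1_regularized_term \<alpha> \<beta> (- of_nat n) z k) =
    pochhammer \<alpha> (Suc n) * pochhammer \<beta> (Suc n) * z ^ Suc n / fact (Suc n) *
    hyp2F1 (\<alpha> + of_nat (Suc n)) (\<beta> + of_nat (Suc n)) (of_nat (n + 2)) z"
proof -
  let ?T = "hyp2F1_regularized_term \<alpha> \<beta> (- of_nat n) z"
  let ?C = "pochhammer \<alpha> (Suc n) * pochhammer \<beta> (Suc n) * z ^ Suc n / fact (Suc n)"
  have "?T k = 0" if "k < Suc n" for k
  proof -
    have "- of_nat n + of_nat k = - (of_nat (n - k) :: complex)"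
      using that by (simp add: of_nat_diff)
    then have "rGamma (- of_nat n + of_nat k :: complex) = 0"
      by (metis minus_of_nat_in_nonpos_Ints rGamma_eq_zero_iff)
    then show ?thesis
      by (simp add: hyp2F1_regularized_term_def)
  qed
  then have "sum ?T {..<Suc n} = 0"
    by simp
  moreover have shift: "?T (k + Suc n) = ?C * hyp2F1_term (\<alpha> + of_nat (Suc n)) (\<beta> + of_nat (Suc n)) (of_nat (n + 2)) z k"
    for k
  proof -
    have "- of_nat n + of_nat (k + Suc n) = (of_nat k + 1 :: complex)"
      by simp
    then have 1: "rGamma (- of_nat n + of_nat (k + Suc n) :: complex) = 1 / fact k"
      by (simp add: rGamma_inverse_Gamma Gamma_fact[symmetric] add.commute divide_inverse)
    have 2: "pochhammer t (k + Suc n) = pochhammer t (Suc n) * pochhammer (t + of_nat (Suc n)) k" for t :: complex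
      using pochhammer_product'[of t "Suc n" k] by (simp only: add.commute)
    have "(of_nat (n + 2) :: complex) = 1 + of_nat (Suc n)"
      by simp
    then have 3: "fact (k + Suc n) = (fact (Suc n) * pochhammer (of_nat (n + 2)) k :: complex)"
      using 2[of 1] by (simp only: pochhammer_fact)
    show ?thesis
      unfolding hyp2F1_regularized_term_def hyp2F1_term_def 1 2 3 power_add pochhammer_fact[symmetric]
      by (simp only: divide_inverse inverse_mult_distrib mult_ac mult_1_left)
  qed
  moreover have "summable ?T"
  proof -
    have "summable (\<lambda>k. ?T (k + Suc n))"
      unfolding shift by (intro summable_mult summable_hyp2F1_term assms)
    then show ?thesis
      by (rule summable_iff_shift[THEN iffD1])
  qed
  ultimately have "suminf ?T = (\<Sum>k. ?T (k + Suc n))"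
    using suminf_split_initial_segment[of ?T "Suc n"] by simp
  also have "\<dots> = ?C * hyp2F1 (\<alpha> + of_nat (Suc n)) (\<beta> + of_nat (Suc n)) (of_nat (n + 2)) z"
    unfolding shift hyp2F1_def by (intro suminf_mult summable_hyp2F1_term assms)
  finally show ?thesis .
qed

text \<open>On a closed disc around \<open>w0\<close> the parameters are bounded, so
  \<open>hyp2F1_ratio_bound\<close> dominates the terms from index \<open>K\<close> on by one
  geometric series, and the Weierstrass test applies.\<close>

lemma isCont_hyp2F1_regularized:
  fixes f g h :: "complex \<Rightarrow> complex"
  assumes z: "norm z < 1" and cont: "continuous_on UNIV f" "continuous_on UNIV g" "continuous_on UNIV h"
  shows "isCont (\<lambda>w. \<Sum>k. hyp2F1_regularized_term (f w) (g w) (h w) z k) w0"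
proof -
  let ?B = "cball w0 1"
  let ?T = "\<lambda>k w. hyp2F1_regularized_term (f w) (g w) (h w) z k"
  have bdd: "\<exists>C. \<forall>w\<in>?B. norm (F w) \<le> C" if "continuous_on UNIV F" for F :: "complex \<Rightarrow> complex"
  proof -
    have "compact (F ` ?B)"
      using that by (intro compact_continuous_image) (auto intro: continuous_on_subset)
    then show ?thesis
      using compact_imp_bounded bounded_iff by (metis image_eqI)
  qed
  obtain C1 C2 C3 where "\<And>w. w \<in> ?B \<Longrightarrow> norm (f w) \<le> C1" "\<And>w. w \<in> ?B \<Longrightarrow> norm (g w) \<le> C2"
    "\<And>w. w \<in> ?B \<Longrightarrow> norm (h w) \<le> C3"
    using bdd[OF cont(1)] bdd[OF cont(2)] bdd[OF cont(3)] by blast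
  moreover define C where "C = max C1 (max C2 C3)"
  ultimately have C: "norm (f w) \<le> C" "norm (g w) \<le> C" "norm (h w) \<le> C" if "w \<in> ?B" for w
    using that by (force simp: max_def)+
  obtain \<rho> K where K: "0 < \<rho>" "\<rho> < 1" "real K > C"
    "\<And>k w. k \<ge> K \<Longrightarrow> w \<in> ?B \<Longrightarrow> norm ((f w + of_nat k) * (g w + of_nat k)) * norm z \<le>
        \<rho> * norm ((h w + of_nat k) * (1 + of_nat k))"
    using hyp2F1_ratio_bound[of "norm z" C] z C by (metis norm_ge_zero)
  have cont_T: "continuous_on UNIV (?T k)" for k
    unfolding hyp2F1_regularized_term_def pochhammer_prod
    by (intro continuous_intros cont continuous_on_compose2[OF continuous_on_rGamma[of UNIV]]) auto
  obtain M where M: "\<And>w. w \<in> ?B \<Longrightarrow> norm (?T K w) \<le> M"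
    using bdd[OF cont_T] by blast
  have step: "norm (?T (Suc k) w) \<le> \<rho> * norm (?T k w)" if "k \<ge> K" "w \<in> ?B" for k w
  proof -
    have "norm (h w) < norm (of_nat k :: complex)"
      using C(3)[OF that(2)] K(3) that(1) by simp
    then have nz: "h w + of_nat k \<noteq> 0"
      by (metis add_eq_0_iff norm_minus_cancel order_less_irrefl)
    then have r: "rGamma (h w + of_nat (Suc k)) = rGamma (h w + of_nat k) / (h w + of_nat k)"
      using rGamma_plus1[of "h w + of_nat k"] by (simp add: field_simps)
    define q where "q = (f w + of_nat k) * (g w + of_nat k) * z / ((h w + of_nat k) * (1 + of_nat k))"
    have T: "?T (Suc k) w = ?T k w * q"
      unfolding q_def hyp2F1_regularized_term_def r by (simp add: pochhammer_Suc mult_ac)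
    have "1 + of_nat k \<noteq> (0 :: complex)"
      by (simp flip: of_nat_Suc)
    then have "norm q \<le> \<rho>"
      unfolding q_def using K(4)[OF that] nz by (simp add: norm_mult norm_divide divide_le_eq)
    from mult_left_mono[OF this norm_ge_zero[of "?T k w"]] show ?thesis
      unfolding T norm_mult by (simp only: mult.commute)
  qed
  have bound: "norm (?T (K + j) w) \<le> M * \<rho> ^ j" if "w \<in> ?B" for j w
  proof (induction j)
    case (Suc j)
    have "norm (?T (K + Suc j) w) \<le> \<rho> * norm (?T (K + j) w)"
      using step[of "K + j" w] that by simp
    also have "\<dots> \<le> \<rho> * (M * \<rho> ^ j)"
      using Suc K(1) by (intro mult_left_mono) auto
    finally show ?case
      by (simp add: mult_ac)
  qed (use M that in simp)
  have "uniform_limit ?B (\<lambda>n w. \<Sum>k<n. ?T k w) (\<lambda>w. \<Sum>k. ?T k w) sequentially"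
  proof (rule Weierstrass_m_test_ev)
    have "\<forall>w\<in>?B. norm (?T n w) \<le> M * \<rho> ^ (n - K)" if "n \<ge> K" for n
      using bound[of _ "n - K"] that by simp
    then show "\<forall>\<^sub>F n in sequentially. \<forall>w\<in>?B. norm (?T n w) \<le> M * \<rho> ^ (n - K)"
      by (auto simp: eventually_sequentially)
    have "summable (\<lambda>n. M * \<rho> ^ (n + K - K))"
      using K by (simp add: summable_mult summable_geometric)
    then show "summable (\<lambda>n. M * \<rho> ^ (n - K))"
      by (rule summable_iff_shift[THEN iffD1])
  qed
  moreover have "continuous_on ?B (\<lambda>w. \<Sum>k<n. ?T k w)" for n
    by (intro continuous_on_sum continuous_on_subset[OF cont_T]) auto
  ultimately have "continuous_on ?B (\<lambda>w. \<Sum>k. ?T k w)"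
    by (intro uniform_limit_theorem[where F = sequentially]) auto
  then show ?thesis
    by (rule continuous_on_interior) simp
qed

text \<open>\<open>Gamma (r * w)\<close> has a pole at \<open>w0\<close>, and the continuous
  regularized factor is nonzero there. The bounds on \<open>\<alpha>\<close> say that
  \<open>\<alpha> + n + 1\<close> lies strictly between 0 and \<open>n + 2\<close>, as Euler's
  integral requires.\<close>

lemma is_pole_hyp_fun:
  fixes p q r a b x :: real and n :: nat
  defines "w0 \<equiv> complex_of_real (- of_nat n / r)"
  defines "\<alpha> \<equiv> a - p / r * of_nat n" and "\<beta> \<equiv> b - q / r * of_nat n"
  assumes "r \<noteq> 0" "\<bar>x\<bar> < 1" "x \<noteq> 0" "pochhammer \<alpha> (Suc n) \<noteq> 0" "pochhammer \<beta> (Suc n) \<noteq> 0"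
    and "0 < \<alpha> + of_nat (Suc n)" "\<alpha> < 1"
  shows "is_pole (hyp_fun (p, q, r, a, b, x)) w0"
proof -
  let ?f = "\<lambda>w. of_real p * w + complex_of_real a"
  let ?g = "\<lambda>w. of_real q * w + complex_of_real b"
  let ?h = "\<lambda>w. complex_of_real r * w"
  define \<Phi> where "\<Phi> = (\<lambda>w. \<Sum>k. hyp2F1_regularized_term (?f w) (?g w) (?h w) (of_real x) k)"
  have w0: "?f w0 = of_real \<alpha>" "?g w0 = of_real \<beta>" "?h w0 = - of_nat n"
    using assms(4) by (simp_all add: w0_def \<alpha>_def \<beta>_def)
  have "hyp2F1 (of_real (\<alpha> + of_nat (Suc n))) (of_real (\<beta> + of_nat (Suc n))) (of_real (of_nat (n + 2))) (of_real x) \<noteq> 0"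
    using assms by (intro hyp2F1_real_nonzero) auto
  moreover have "pochhammer (complex_of_real \<alpha>) (Suc n) \<noteq> 0" "pochhammer (complex_of_real \<beta>) (Suc n) \<noteq> 0"
    using assms(7,8) by (simp_all only: pochhammer_of_real of_real_eq_0_iff not_False_eq_True)
  ultimately have "\<Phi> w0 \<noteq> 0"
    using assms(5,6) unfolding \<Phi>_def w0
    by (subst hyp2F1_regularized_nonpos_Int) (simp_all del: pochhammer_Suc of_nat_Suc of_nat_add)
  have "isCont \<Phi> w0"
    unfolding \<Phi>_def using assms(5) by (intro isCont_hyp2F1_regularized continuous_intros) auto
  have "filterlim ?h (at (- of_nat n)) (at w0)"
  proof (rule filterlim_atI)
    show "(?h \<longlongrightarrow> - of_nat n) (at w0)"
      unfolding w0(3)[symmetric] by (intro tendsto_intros)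
    show "\<forall>\<^sub>F w in at w0. ?h w \<noteq> - of_nat n"
      unfolding w0(3)[symmetric] using assms(4) by (simp add: eventually_at_filter)
  qed
  then have "filterlim (\<lambda>w. Gamma (?h w)) at_infinity (at w0)"
    by (rule filterlim_compose[OF Gamma_poles])
  from tendsto_mult_filterlim_at_infinity[OF isContD[OF \<open>isCont \<Phi> w0\<close>] \<open>\<Phi> w0 \<noteq> 0\<close> this]
  have "filterlim (\<lambda>w. \<Phi> w * Gamma (?h w)) at_infinity (at w0)" .
  moreover have "\<forall>\<^sub>F w in at w0. ?h w \<notin> \<int>\<^sub>\<le>\<^sub>0"
    using cosparse_not_nonpos_Int[of "of_real r"] assms(4) by (simp add: eventually_cosparse_UNIV)
  then have "\<forall>\<^sub>F w in at w0. \<Phi> w * Gamma (?h w) = hyp_fun (p, q, r, a, b, x) w"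
    by eventually_elim (use assms(5) in \<open>simp add: \<Phi>_def hyp2F1_eq_Gamma_mult\<close>)
  ultimately show ?thesis
    unfolding is_pole_def using filterlim_cong[OF refl refl] by fast
qed

subsection \<open>Parameters without poles\<close>

text \<open>Neither progression can contain two consecutive integers unless its step is an integer, so two
  progressions that cover all large integers must alternate.\<close>

lemma progressions_cover_imp:
  fixes P Q a b :: real
  assumes P: "0 < P" "P < 1"
    and cover: "\<And>n. n \<ge> N \<Longrightarrow> a - P * real n \<in> \<int> \<or> (\<exists>k\<le>n. b - Q * real n = - real k)"
  shows "Q = 0 \<and> b \<in> \<int>\<^sub>\<le>\<^sub>0 \<or> Q = 1 \<and> - b \<in> \<int>\<^sub>\<le>\<^sub>0 \<or>
    P = 1 / 2 \<and> Q = 1 / 2 \<and> (a \<in> \<int> \<and> b + 1 / 2 \<in> \<int> \<or> a + 1 / 2 \<in> \<int> \<and> b \<in> \<int>)"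
proof -
  define A where "A = (\<lambda>n. a - P * real n \<in> \<int>)"
  define B where "B = (\<lambda>n. \<exists>k\<le>n. b - Q * real n = - real k)"
  have AB: "A n \<or> B n" if "n \<ge> N" for n
    using cover[OF that] by (simp add: A_def B_def)
  have not_Int: "t \<notin> \<int>" if "0 < t" "t < 1" for t :: real
    using that by (auto elim!: Ints_cases)
  have A_diff: "P * real k \<in> \<int>" if "A n" "A (n + k)" for n k
  proof -
    have "P * real k = (a - P * real n) - (a - P * real (n + k))"
      by (simp add: algebra_simps)
    then show ?thesis
      using that unfolding A_def by (metis Ints_diff)
  qed
  have B_Int: "b - Q * real n \<in> \<int>" if "B n" for n
    using that by (auto simp: B_def)
  have B_diff: "Q * real k \<in> \<int>" if "B n" "B (n + k)" for n k
  proof -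
    have "Q * real k = (b - Q * real n) - (b - Q * real (n + k))"
      by (simp add: algebra_simps)
    then show ?thesis
      using that B_Int by (metis Ints_diff)
  qed
  have not_AA: "\<not> (A n \<and> A (n + 1))" for n
    using A_diff[of n 1] not_Int[OF P] by auto
  have B_next: "\<exists>m\<ge>n. B m" if "n \<ge> N" for n
    using AB[of n] AB[of "n + 1"] not_AA[of n] that by (metis le_add1 order_refl le_trans)
  have B_bounds: "b \<le> Q * real n" "(Q - 1) * real n \<le> b" if "B n" for n
    using that by (auto simp: B_def algebra_simps)
  \<comment> \<open>Since \<open>B\<close> holds for arbitrarily large indices, the inequalities
    \<open>B_bounds\<close> confine \<open>Q\<close> to the interval from 0 to 1.\<close>
  have "Q \<ge> 0"
  proof (rule ccontr)
    assume "\<not> Q \<ge> 0"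
    then have "- Q > 0"
      by simp
    then obtain n where n: "- b < real n * (- Q)"
      using reals_Archimedean3 by blast
    obtain m where m: "m \<ge> max n N" "B m"
      using B_next[of "max n N"] by auto
    have "real n * (- Q) \<le> real m * (- Q)"
      using m \<open>\<not> Q \<ge> 0\<close> by (intro mult_right_mono) auto
    with n B_bounds(1)[OF m(2)] show False
      by (simp add: mult.commute)
  qed
  have "Q \<le> 1"
  proof (rule ccontr)
    assume "\<not> Q \<le> 1"
    then have "Q - 1 > 0"
      by simp
    then obtain n where n: "b < real n * (Q - 1)"
      using reals_Archimedean3 by blast
    obtain m where m: "m \<ge> max n N" "B m"
      using B_next[of "max n N"] by auto
    have "real n * (Q - 1) \<le> real m * (Q - 1)"
      using m \<open>\<not> Q \<le> 1\<close> by (intro mult_right_mono) auto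
    with n B_bounds(2)[OF m(2)] show False
      by (simp add: mult.commute)
  qed
  show ?thesis
  proof (cases "Q \<in> \<int>")
    case True
    then have "Q = 0 \<or> Q = 1"
      using \<open>Q \<ge> 0\<close> \<open>Q \<le> 1\<close> not_Int[of Q] by (auto simp: order_le_less)
    moreover obtain m where "B m"
      using B_next[of N] by auto
    then obtain k where k: "k \<le> m" "b - Q * real m = - real k"
      by (auto simp: B_def)
    have "b \<in> \<int>\<^sub>\<le>\<^sub>0" if "Q = 0"
      using k(2) that by (simp add: minus_of_nat_in_nonpos_Ints)
    moreover have "- b \<in> \<int>\<^sub>\<le>\<^sub>0" if "Q = 1"
    proof -
      have "- b = - real (m - k)"
        using k that by (simp add: of_nat_diff)
      then show ?thesis
        by (metis minus_of_nat_in_nonpos_Ints)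
    qed
    ultimately show ?thesis
      by blast
  next
    case False
    then have not_BB: "\<not> (B n \<and> B (n + 1))" for n
      using B_diff[of n 1] by auto
    \<comment> \<open>As neither \<open>A\<close> nor \<open>B\<close> holds twice in a row, each
      recurs after two steps. Hence \<open>2 P\<close> and \<open>2 Q\<close> are integers strictly
      between 0 and 2.\<close>
    have A2: "A (n + 2)" if "n \<ge> N" "A n" for n
      using AB[of "n + 1"] AB[of "n + 2"] not_AA[of n] not_BB[of "n + 1"] that by (auto simp: numeral_2_eq_2)
    have B2: "B (n + 2)" if "n \<ge> N" "B n" for n
      using AB[of "n + 1"] AB[of "n + 2"] not_BB[of n] not_AA[of "n + 1"] that by (auto simp: numeral_2_eq_2)
    have half: "t = 1 / 2" if t: "t * real 2 \<in> \<int>" "0 < t" "t < 1" for t :: real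
    proof -
      obtain k where "t * real 2 = of_int k"
        using t(1) by (rule Ints_cases)
      then have k: "t * 2 = of_int k"
        by simp
      with t have "real_of_int k > 0" "real_of_int k < 2"
        by linarith+
      then have "k = 1"
        by linarith
      with k show ?thesis
        by simp
    qed
    obtain m m' where "m \<ge> N" "A m" "m' \<ge> N" "B m'"
      using AB[of N] AB[of "N + 1"] not_AA[of N] not_BB[of N] by (metis le_add1 order_refl)
    then have "P * real 2 \<in> \<int>" "Q * real 2 \<in> \<int>"
      using A2 B2 A_diff[of m 2] B_diff[of m' 2] by blast+
    moreover have "0 < Q" "Q < 1"
      using False \<open>Q \<ge> 0\<close> \<open>Q \<le> 1\<close> by (metis Ints_0 order_le_less, metis Ints_1 order_le_less)
    ultimately have PQ: "P = 1 / 2" "Q = 1 / 2"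
      using half P by blast+
    have shift: "t \<in> \<int>" if "t - 1 / 2 * real (2 * N) \<in> \<int>" for t :: real
      using Ints_add[OF that Ints_of_nat[of N]] by simp
    have shift_half: "t + 1 / 2 \<in> \<int>" if "t - 1 / 2 * real (2 * N + 1) \<in> \<int>" for t :: real
    proof -
      have "t + 1 / 2 = (t - 1 / 2 * real (2 * N + 1)) + real (N + 1)"
        by (simp add: field_simps)
      then show ?thesis
        using that Ints_add Ints_of_nat by metis
    qed
    have "a \<in> \<int> \<and> b + 1 / 2 \<in> \<int> \<or> a + 1 / 2 \<in> \<int> \<and> b \<in> \<int>"
    \<comment> \<open>The parity of the indices where \<open>A\<close> holds decides which of
      \<open>a\<close> and \<open>b\<close> is the integer and which is the half-integer; the index
      \<open>2 * N\<close> is even and at least \<open>N\<close>.\<close>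
    proof (cases "A (2 * N)")
      case True
      then have "B (2 * N + 1)"
        using AB[of "2 * N + 1"] not_AA[of "2 * N"] by auto
      then have "b + 1 / 2 \<in> \<int>"
        using B_Int[of "2 * N + 1"] shift_half unfolding PQ by blast
      moreover have "a \<in> \<int>"
        using True shift unfolding A_def PQ by blast
      ultimately show ?thesis
        by blast
    next
      case False
      then have B: "B (2 * N)"
        using AB[of "2 * N"] by auto
      then have "A (2 * N + 1)"
        using AB[of "2 * N + 1"] not_BB[of "2 * N"] by auto
      then have "a + 1 / 2 \<in> \<int>"
        using shift_half unfolding A_def PQ by blast
      moreover have "b \<in> \<int>"
        using B_Int[OF B] shift unfolding PQ by blast
      ultimately show ?thesis
        by blast
    qed
    with PQ show ?thesis
      by blast
  qed
qed

text \<open>The conditions that E1 or E2, applied to the members of the symmetry orbit of a parameter,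
  impose on the parameter itself.\<close>

definition orbit_condition :: "real \<Rightarrow> real \<Rightarrow> real \<Rightarrow> real \<Rightarrow> real \<Rightarrow> bool" where
  "orbit_condition p q r a b \<longleftrightarrow>
     q = 0 \<and> b \<in> \<int>\<^sub>\<le>\<^sub>0 \<or> p = 0 \<and> a \<in> \<int>\<^sub>\<le>\<^sub>0 \<or> q = r \<and> - b \<in> \<int>\<^sub>\<le>\<^sub>0 \<or> p = r \<and> - a \<in> \<int>\<^sub>\<le>\<^sub>0 \<or>
     p = r / 2 \<and> q = r / 2 \<and> (a \<in> \<int> \<and> b + 1 / 2 \<in> \<int> \<or> a + 1 / 2 \<in> \<int> \<and> b \<in> \<int>)"

lemma orbit_condition_swap: "orbit_condition q p r b a \<longleftrightarrow> orbit_condition p q r a b"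
  unfolding orbit_condition_def by blast

text \<open>The reflection exchanges the cases \<open>q = 0\<close> and \<open>q = r\<close> and
  fixes the case \<open>q = r / 2\<close>, half-integrality being invariant under a change of
  sign.\<close>

lemma orbit_condition_reflect: "orbit_condition p (r - q) r a (- b) \<longleftrightarrow> orbit_condition p q r a b"
proof -
  have "- b + 1 / 2 = 1 - (b + 1 / 2)"
    by simp
  then have "- b + 1 / 2 \<in> \<int> \<longleftrightarrow> b + 1 / 2 \<in> \<int>"
    by (metis Ints_1 Ints_diff diff_diff_eq2 add_diff_cancel_left' add.commute)
  moreover have "r - q = 0 \<longleftrightarrow> q = r" "r - q = r \<longleftrightarrow> q = 0" "r - q = r / 2 \<longleftrightarrow> q = r / 2"
    by auto
  ultimately show ?thesis
    unfolding orbit_condition_def by auto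
qed

lemma orbit_condition_reflect': "orbit_condition (r - p) q r (- a) b \<longleftrightarrow> orbit_condition p q r a b"
  using orbit_condition_reflect[of q r p b a] orbit_condition_swap by blast

text \<open>The condition is invariant under each generator, S1 acting on it as the composition of
  the two reflections, so it can be carried back along the chain.\<close>

lemma orbit_condition_if_reachable:
  assumes "symmetry\<^sup>*\<^sup>* (p, q, r, a, b, x) (p', q', r', a', b', x')" "orbit_condition p' q' r' a' b'"
  shows "orbit_condition p q r a b"
  using assms
proof (induction "(p, q, r, a, b, x)" arbitrary: p q r a b x rule: converse_rtranclp_induct)
  case (step nu)
  then show ?case
    by (cases nu) (auto elim!: symmetry.cases simp: orbit_condition_swap orbit_condition_reflect orbit_condition_reflect')
qed

text \<open>For the converse, at most two steps suffice, and only S0 and S1 are used. These keep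
  \<open>x\<close> unchanged, so the target stays in the region.\<close>

lemma orbit_condition_iff:
  assumes "0 < p \<and> p < r \<or> 0 < q \<and> q < r" "- 1 < x" "x < 1" "x \<noteq> 0"
  shows "(\<exists>mu. symmetry\<^sup>*\<^sup>* (p, q, r, a, b, x) mu \<and> in_region mu \<and> (cond_E1 mu \<or> (\<exists>i j. cond_E2 i j mu))) \<longleftrightarrow>
    orbit_condition p q r a b"
    (is "(\<exists>mu. ?reach mu \<and> in_region mu \<and> ?E mu) \<longleftrightarrow> ?C")
proof
  assume "\<exists>mu. ?reach mu \<and> in_region mu \<and> ?E mu"
  then obtain p' q' r' a' b' x' where mu: "?reach (p', q', r', a', b', x')" "?E (p', q', r', a', b', x')"
    by auto
  from mu(2) have "orbit_condition p' q' r' a' b'"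
    by (auto simp: orbit_condition_def)
  with mu(1) show ?C
    by (rule orbit_condition_if_reachable)
next
  assume ?C
  then consider "q = 0 \<and> b \<in> \<int>\<^sub>\<le>\<^sub>0" | "p = 0 \<and> a \<in> \<int>\<^sub>\<le>\<^sub>0" | "q = r \<and> - b \<in> \<int>\<^sub>\<le>\<^sub>0" | "p = r \<and> - a \<in> \<int>\<^sub>\<le>\<^sub>0"
    | i j :: int where "p = r / 2" "q = r / 2" "a = of_int i" "b = of_int j - 1 / 2"
    | i j :: int where "p = r / 2" "q = r / 2" "b = of_int i" "a = of_int j - 1 / 2"
    unfolding orbit_condition_def by (metis Ints_cases eq_diff_eq)
  then show "\<exists>mu. ?reach mu \<and> in_region mu \<and> ?E mu"
  proof cases
    case 1
    with assms show ?thesis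
      by (intro exI[of _ "(p, q, r, a, b, x)"]) simp
  next
    case 2
    have "?reach (q, p, r, b, a, x)"
      by (intro r_into_rtranclp symmetry.S0)
    with 2 assms show ?thesis
      by (intro exI[of _ "(q, p, r, b, a, x)"]) auto
  next
    case 3
    have "?reach (r - p, r - q, r, - a, - b, x)"
      by (intro r_into_rtranclp symmetry.S1)
    with 3 assms show ?thesis
      by (intro exI[of _ "(r - p, r - q, r, - a, - b, x)"]) auto
  next
    case 4
    have "?reach (r - q, r - p, r, - b, - a, x)"
      by (rule rtranclp_trans[OF r_into_rtranclp[of symmetry, OF symmetry.S1] r_into_rtranclp[of symmetry, OF symmetry.S0]])
    with 4 assms show ?thesis
      by (intro exI[of _ "(r - q, r - p, r, - b, - a, x)"]) auto
  next
    case 5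
    with assms have "cond_E2 i j (p, q, r, a, b, x)"
      by auto
    with assms show ?thesis
      by (intro exI[of _ "(p, q, r, a, b, x)"]) auto
  next
    case 6
    have "?reach (q, p, r, b, a, x)"
      by (intro r_into_rtranclp symmetry.S0)
    moreover have "cond_E2 i j (q, p, r, b, a, x)"
      using 6 assms by auto
    ultimately show ?thesis
      using assms by (intro exI[of _ "(q, p, r, b, a, x)"]) auto
  qed
qed

section \<open>Necessity: finitely many poles force the orbit condition\<close>

lemma elementary_solution_swap:
  "elementary_solution (q, p, r, b, a, x) \<longleftrightarrow> elementary_solution (p, q, r, a, b, x)"
proof -
  have "hyp_fun (q, p, r, b, a, x) = hyp_fun (p, q, r, a, b, x)"
    using hyp2F1_commute by (simp add: fun_eq_iff)
  then show ?thesis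
    by (simp add: elementary_solution_def closed_form_solution_def)
qed

lemma elementary_imp_orbit_condition:
  assumes p: "0 < p" "p < r" and x: "- 1 < x" "x < 1" "x \<noteq> 0"
    and "elementary_solution (p, q, r, a, b, x)"
  shows "orbit_condition p q r a b"
proof -
  have "r > 0"
    using p by simp
  define P Q where "P = p / r" and "Q = q / r"
  have P: "0 < P" "P < 1"
    using p by (simp_all add: P_def)
  define w where "w = (\<lambda>n. complex_of_real (- of_nat n / r))"
  have "inj w"
    using \<open>r > 0\<close> by (auto simp: inj_def w_def)
  then have "finite (w -` {w. is_pole (hyp_fun (p, q, r, a, b, x)) w})"
    using assms(6) by (intro finite_vimageI) (simp_all add: elementary_solution_def)
  then have "finite {n. is_pole (hyp_fun (p, q, r, a, b, x)) (w n)}"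
    by (simp add: vimage_def)
  then obtain N1 where N1: "\<And>n. n \<ge> N1 \<Longrightarrow> \<not> is_pole (hyp_fun (p, q, r, a, b, x)) (w n)"
    by (metis (mono_tags, lifting) finite_nat_set_iff_bounded mem_Collect_eq not_less)
  \<comment> \<open>\<open>N2\<close> and \<open>N3\<close> put \<open>a - P n\<close> strictly
    between \<open>-n\<close> and 0 for large \<open>n\<close>. The pole criterion then leaves only
    the vanishing of one of the two Pochhammer symbols.\<close>
  obtain N2 where N2: "a < real N2 * P"
    using reals_Archimedean3[OF P(1)] by blast
  obtain N3 where N3: "- a < real N3 * (1 - P)"
    using reals_Archimedean3[of "1 - P"] P(2) by auto
  have cover: "a - P * real n \<in> \<int> \<or> (\<exists>k\<le>n. b - Q * real n = - real k)" if n: "n \<ge> max N1 (max N2 N3)" for n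
  proof -
    let ?\<alpha> = "a - p / r * of_nat n" and ?\<beta> = "b - q / r * of_nat n"
    have "real N2 * P \<le> real n * P" "real N3 * (1 - P) \<le> real n * (1 - P)"
      using n P by (auto intro!: mult_right_mono)
    then have \<alpha>: "0 < ?\<alpha> + of_nat (Suc n)" "?\<alpha> < 1"
      using N2 N3 by (simp_all add: P_def[symmetric] algebra_simps)
    have "r \<noteq> 0" "\<bar>x\<bar> < 1"
      using \<open>r > 0\<close> x by auto
    from is_pole_hyp_fun[OF this x(3) _ _ \<alpha>]
    have "pochhammer ?\<alpha> (Suc n) = 0 \<or> pochhammer ?\<beta> (Suc n) = 0"
      using N1[of n] n unfolding w_def by (meson max.boundedE)
    then have "(\<exists>k<Suc n. a - P * real n = - real k) \<or> (\<exists>k<Suc n. b - Q * real n = - real k)"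
      unfolding pochhammer_eq_0_iff P_def Q_def .
    then show ?thesis
      by (auto simp: less_Suc_eq_le)
  qed
  have "Q = 0 \<and> b \<in> \<int>\<^sub>\<le>\<^sub>0 \<or> Q = 1 \<and> - b \<in> \<int>\<^sub>\<le>\<^sub>0 \<or> P = 1 / 2 \<and> Q = 1 / 2 \<and>
      (a \<in> \<int> \<and> b + 1 / 2 \<in> \<int> \<or> a + 1 / 2 \<in> \<int> \<and> b \<in> \<int>)"
    by (rule progressions_cover_imp[OF P, where N = "max N1 (max N2 N3)"]) (rule cover)
  moreover have "Q = 0 \<longleftrightarrow> q = 0" "Q = 1 \<longleftrightarrow> q = r" "P = 1 / 2 \<longleftrightarrow> p = r / 2" "Q = 1 / 2 \<longleftrightarrow> q = r / 2"
    using \<open>r > 0\<close> by (auto simp: P_def Q_def field_simps)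
  ultimately show ?thesis
    unfolding orbit_condition_def by blast
qed

section \<open>The closed form in case E2, and sufficiency\<close>

lemma S_fun_eq_bessel:
  "S_fun i j x w = of_real ((1 - x) powr (- (of_int (i + j) / 2))) *
     pochhammer_functional w (bessel_poly (i + j) (of_real (- ((1 - sqrt (1 - x)) / (2 * sqrt (1 - x))))) *
       bessel_poly (j - i) (of_real ((1 - sqrt (1 - x)) / 2)))"
proof -
  have "1 + i - j = 1 - (j - i)" "1 - i - j = 1 - (i + j)"
    by simp_all
  then show ?thesis
    unfolding S_fun_def by (simp only: appell_F3_reflected)
qed

lemma hyp2F1_eq_S_fun:
  assumes "- 1 < x" "x < 1" "x \<noteq> 0" "w \<notin> \<int>\<^sub>\<le>\<^sub>0"
  shows "hyp2F1 (w / 2 + of_int i) ((w - 1) / 2 + of_int j) w (of_real x) =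
    S_fun i j x w * of_real ((1 + sqrt (1 - x)) / 2) powr (1 - w)"
proof -
  have args: "(w + of_int (i + j) - of_int (j - i)) / 2 = w / 2 + of_int i"
    "(w - 1 + of_int (i + j) + of_int (j - i)) / 2 = (w - 1) / 2 + of_int j"
    by (simp_all add: field_simps)
  have "- (of_int (i + j) / 2) = 1 / 2 * (of_int (- (i + j)) :: real)"
    by (simp only: of_int_minus)
  \<comment> \<open>The real power in \<open>S_fun\<close> is an integer power of the square root,
    as in the closed form in terms of Bessel polynomials.\<close>
  then have "(1 - x) powr (- (of_int (i + j) / 2)) = ((1 - x) powr (1 / 2)) powr of_int (- (i + j))"
    by (simp only: powr_powr)
  also have "\<dots> = sqrt (1 - x) powi (- (i + j))"
    using assms by (subst powr_real_of_int') (simp_all add: powr_half_sqrt)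
  finally have "of_real ((1 - x) powr (- (of_int (i + j) / 2))) = complex_of_real (sqrt (1 - x)) powi (- (i + j))"
    by (simp only: of_real_power_int)
  then show ?thesis
    using hyp2F1_dihedral[OF assms, of "i + j" "j - i"] unfolding S_fun_eq_bessel args
    by (simp only: mult_ac)
qed

lemma is_rational_function_S_fun: "is_rational_function (S_fun i j x)"
  unfolding S_fun_eq_bessel[abs_def] pochhammer_functional_bessel_product
  by (intro is_rational_function_intros)

lemma S_fun_0_0:
  assumes "x < 1"
  shows "S_fun 0 0 x w = 1"
proof -
  have "appell_F3 (of_int 0) (of_int 0) (of_int (1 - 0)) (of_int (1 - 0)) w u v = 1" for u v
    unfolding appell_F3_reflected by (simp add: bessel_poly_0 pochhammer_functional_1)
  with assms show ?thesis
    by (simp add: S_fun_def)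
qed

text \<open>In each case the function is an exponential times a rational function; the remaining
  disjuncts follow by exchanging the two numerator parameters.\<close>

lemma orbit_condition_imp_elementary:
  assumes "r > 0" and x: "- 1 < x" "x < 1" "x \<noteq> 0" and "orbit_condition p q r a b"
  shows "elementary_solution (p, q, r, a, b, x)"
proof -
  have r: "\<forall>\<^sub>\<approx>w. complex_of_real r * w \<notin> \<int>\<^sub>\<le>\<^sub>0"
    using assms(1) by (intro cosparse_not_nonpos_Int) simp
  have terminating: "elementary_solution (p, 0, r, a, b, x)" if "b \<in> \<int>\<^sub>\<le>\<^sub>0" for p a b
    using is_rational_function_hyp_fun_terminating[OF that, of p r a x]
    by (rule elementary_exp_times_rational[where \<kappa> = 0]) simp
  have exceeds: "elementary_solution (p, r, r, a, b, x)" if b: "- b \<in> \<int>\<^sub>\<le>\<^sub>0" for p a b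
  proof -
    obtain n where "- b = - of_nat n"
      using b by (elim nonpos_Ints_cases')
    then have n: "b = of_nat n"
      by simp
    have norm: "norm (complex_of_real x) < 1"
      using x by simp
    obtain R where R: "is_rational_function R" "\<And>w. complex_of_real r * w \<notin> \<int>\<^sub>\<le>\<^sub>0 \<Longrightarrow>
      hyp2F1 (of_real p * w + of_real a) (of_real r * w + of_nat n) (of_real r * w) (of_real x) =
      (1 - of_real x) powr (- (of_real p * w)) * R w"
      using hyp2F1_numerator_exceeds_denominator[OF norm, of "of_real r" 0 "of_real p" "of_real a" n] by auto
    have "1 - complex_of_real x \<noteq> 0"
      using x by (metis eq_iff_diff_eq_0 of_real_eq_1_iff order_less_irrefl)
    then have powr: "(1 - complex_of_real x) powr (- (of_real p * w)) =
        exp (- (of_real p * Ln (1 - of_real x)) * w)" for w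
      by (simp add: powr_def mult_ac)
    have "\<forall>\<^sub>\<approx>w. hyp_fun (p, r, r, a, b, x) w = exp (- (of_real p * Ln (1 - of_real x)) * w) * R w"
      using r
    proof eventually_elim
      case (elim w)
      then show ?case
        using R(2)[OF elim] unfolding powr by (simp add: n)
    qed
    with R(1) show ?thesis
      by (rule elementary_exp_times_rational)
  qed
  have dihedral: "elementary_solution (r / 2, r / 2, r, of_int i, of_int j - 1 / 2, x)" for i j :: int
  proof -
    define c where "c = complex_of_real ((1 + sqrt (1 - x)) / 2)"
    have "c \<noteq> 0"
    proof -
      have "(1 + sqrt (1 - x)) / 2 > 0"
        using x by (simp add: add_pos_nonneg)
      then show ?thesis
        unfolding c_def by (metis of_real_eq_0_iff order_less_irrefl)
    qed
    \<comment> \<open>The constant \<open>c\<close> is split off from the power with exponent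
      \<open>1 - r * w\<close>, so that a pure exponential in \<open>w\<close> remains.\<close>
    have "is_rational_function (\<lambda>w. S_fun i j x (of_real r * w) * c)"
      using is_rational_function_affine[OF is_rational_function_S_fun, of "of_real r" i j x 0] assms(1)
      by (intro is_rational_function_intros) simp
    moreover have "\<forall>\<^sub>\<approx>w. hyp_fun (r / 2, r / 2, r, of_int i, of_int j - 1 / 2, x) w =
        exp (- (of_real r * Ln c) * w) * (S_fun i j x (of_real r * w) * c)"
      using r
    proof eventually_elim
      case (elim w)
      have "hyp_fun (r / 2, r / 2, r, of_int i, of_int j - 1 / 2, x) w =
          hyp2F1 (of_real r * w / 2 + of_int i) ((of_real r * w - 1) / 2 + of_int j) (of_real r * w) (of_real x)"
        unfolding hyp_fun.simps by (rule arg_cong2[where f = "\<lambda>\<alpha> \<beta>. hyp2F1 \<alpha> \<beta> _ _"]) (simp_all add: field_simps)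
      also have "\<dots> = S_fun i j x (of_real r * w) * c powr (1 - of_real r * w)"
        unfolding c_def by (rule hyp2F1_eq_S_fun[OF x elim])
      also have "c powr (1 - of_real r * w) = c * exp (- (of_real r * Ln c) * w)"
      proof -
        have "c powr (1 - of_real r * w) = exp ((1 - of_real r * w) * Ln c)"
          using \<open>c \<noteq> 0\<close> by (simp add: powr_def)
        also have "(1 - of_real r * w) * Ln c = Ln c + - (of_real r * Ln c) * w"
          by (simp add: algebra_simps)
        also have "exp \<dots> = c * exp (- (of_real r * Ln c) * w)"
          unfolding exp_add exp_Ln[OF \<open>c \<noteq> 0\<close>] ..
        finally show ?thesis .
      qed
      finally show ?case
        by (simp add: mult_ac)
    qed
    ultimately show ?thesis
      by (rule elementary_exp_times_rational)
  qed
  have dihedral': "elementary_solution (r / 2, r / 2, r, a, b, x)" if ab: "a \<in> \<int>" "b + 1 / 2 \<in> \<int>" for a b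
  proof -
    obtain i where "a = of_int i"
      using ab(1) by (rule Ints_cases)
    moreover obtain j where "b + 1 / 2 = of_int j"
      using ab(2) by (rule Ints_cases)
    then have "b = of_int j - 1 / 2"
      by simp
    ultimately show ?thesis
      using dihedral by simp
  qed
  from assms(5) show ?thesis
    unfolding orbit_condition_def
    using terminating[of b p a] terminating[of a q b] exceeds[of b p a] exceeds[of a q b]
      dihedral'[of a b] dihedral'[of b a]
      elementary_solution_swap[of q p r b a x] by auto
qed

theorem theorem2p1:
  fixes p q r a b x :: real
  assumes "0 < p \<and> p < r \<or> 0 < q \<and> q < r"
    and "- 1 < x" and "x < 1" and "x \<noteq> 0"
  shows
    "(elementary_solution (p, q, r, a, b, x) \<longleftrightarrow>
        (\<exists>mu. symmetry\<^sup>*\<^sup>* (p, q, r, a, b, x) mu \<and> in_region mu \<and>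
              (cond_E1 mu \<or> (\<exists>i j. cond_E2 i j mu)))) \<and>
     (\<forall>p' q' r' a' b' x'.
        symmetry\<^sup>*\<^sup>* (p, q, r, a, b, x) (p', q', r', a', b', x') \<and>
        in_region (p', q', r', a', b', x') \<longrightarrow>
        (cond_E1 (p', q', r', a', b', x') \<longrightarrow>
           is_rational_function (hyp_fun (p', q', r', a', b', x')) \<and>
           (\<exists>N. \<forall>w. \<forall>k>N.
              hyp2F1_term (of_real p' * w + of_real a') (of_real q' * w + of_real b')
                (of_real r' * w) (of_real x') k = 0)) \<and>
        (\<forall>i j. cond_E2 i j (p', q', r', a', b', x') \<longrightarrow>
           (\<forall>w. w \<notin> \<int>\<^sub>\<le>\<^sub>0 \<longrightarrow>
              hyp_fun (p', q', r', a', b', x') (w / of_real r') =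
                hyp2F1 (w / 2 + of_int i) ((w - 1) / 2 + of_int j) w (of_real x') \<and>
              hyp2F1 (w / 2 + of_int i) ((w - 1) / 2 + of_int j) w (of_real x') =
                S_fun i j x' w * of_real ((1 + sqrt (1 - x')) / 2) powr (1 - w)) \<and>
           (\<forall>w. S_fun 0 0 x' w = 1) \<and>
           is_rational_function (S_fun i j x')))"
proof (intro conjI allI impI, goal_cases)
  case 1
  \<comment> \<open>When only \<open>0 < q < r\<close> is given, necessity is applied to the swapped
    parameter; both sides are invariant under the swap.\<close>
  have "elementary_solution (p, q, r, a, b, x) \<longleftrightarrow> orbit_condition p q r a b"
    using assms elementary_imp_orbit_condition[of p r x q a b] elementary_imp_orbit_condition[of q r x p b a]
      orbit_condition_imp_elementary[of r x p q a b]
    unfolding elementary_solution_swap[of q] orbit_condition_swap[of q] by linarith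
  then show ?case
    unfolding orbit_condition_iff[OF assms] .
next
  case (2 p' q' r' a' b' x')
  then show ?case
    using is_rational_function_hyp_fun_terminating by simp
next
  case (3 p' q' r' a' b' x')
  then show ?case
    using hyp2F1_term_eventually_zero[of b'] by simp blast
next
  case (4 p' q' r' a' b' x' i j w)
  then have "p' \<noteq> 0" "r' = 2 * p'" "q' = p'" "a' = of_int i" "b' = of_int j - 1 / 2"
    by auto
  then have "of_real p' * (w / of_real r') + of_real a' = w / 2 + of_int i"
    "of_real q' * (w / of_real r') + of_real b' = (w - 1) / 2 + of_int j"
    "of_real r' * (w / of_real r') = w"
    by (simp_all add: diff_divide_distrib)
  then show ?case
    by (simp only: hyp_fun.simps)
next
  case (5 p' q' r' a' b' x' i j w)
  then show ?case
    by (intro hyp2F1_eq_S_fun) auto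
next
  case (6 p' q' r' a' b' x' i j w)
  then show ?case
    by (intro S_fun_0_0) auto
next
  case (7 p' q' r' a' b' x' i j)
  show ?case
    by (rule is_rational_function_S_fun)
qed

end
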